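(* Let $n\ge1$, $N\in\mathbb{N}$, and let $K\subseteq\mathbb{S}^n$ be compact and proper with $\lambda_n(K)>0$. Then $$\mathbb{E}\,\lambda_n([K]_N^* )\ \le\ \mathbb{E}\,\lambda_n([C_K]_N^* ),$$ where $C_K$ is a spherical cap satisfying $\lambda_n(K)=\lambda_n(C_K)$.
   Context: $\mathbb{S}^n=\{x\in\mathbb{R}^{n+1}: x\cdot x=1\}$ with the Euclidean scalar product; $\lambda_n$ is the rotation-invariant $n$-dimensional Hausdorff measure on $\mathbb{S}^n$. A spherical cap is a geodesic ball for the distance $\arccos(x\cdot y)$. A set $K\subseteq\mathbb{S}^n$ is convex if for all $x,y\in K$ with $x\neq-y$ the shortest geodesic segment $[x,y]$ lies in $K$; $\mathrm{conv}\,K$ is the intersection of all convex sets containing $K$. A closed subset of $\mathbb{S}^n$ is proper if it is contained in an open hemisphere. For $K\subseteq\mathbb{S}^n$ the polar set is $K^*=\{x\in\mathbb{S}^n: x\cdot y\le 0\text{ for all }y\in K\}$. For a compact $L\subseteq\mathbb{S}^n$ with $\lambda_n(L)>0$, $[L]_N=\mathrm{conv}\{X_1,\ldots,X_N\}$, where $X_1,\ldots,X_N$ are independent random points distributed uniformly in $L$ (with respect to $\lambda_n$), and $[L]_N^*=([L]_N)^*$; $\mathbb{E}$ denotes expectation. *)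

theory Defs
  imports "HOL-Probability.Probability"
begin

text \<open>
  The \<open>d\<close>-dimensional Hausdorff measure, normalised so that it agrees with Lebesgue measure
  on \<open>d\<close>-dimensional Euclidean space. The library function \<^const>\<open>diameter\<close> is only meaningful
  on bounded sets, hence the boundedness condition on the covering sets. The case distinction
  on the empty set only matters for \<open>d = 0\<close>.
\<close>

definition hausdorff_pre :: "nat \<Rightarrow> real \<Rightarrow> 'a::metric_space set \<Rightarrow> ennreal" where
  "hausdorff_pre d \<delta> A =
     (INF U \<in> {U :: nat \<Rightarrow> 'a set. A \<subseteq> (\<Union>i. U i) \<and> (\<forall>i. bounded (U i) \<and> diameter (U i) \<le> \<delta>)}.
        \<Sum>i. if U i = {} then 0
             else ennreal (unit_ball_vol (real d) * (diameter (U i) / 2) ^ d))"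

definition hausdorff_outer :: "nat \<Rightarrow> 'a::metric_space set \<Rightarrow> ennreal" where
  "hausdorff_outer d A = (SUP \<delta> \<in> {0<..}. hausdorff_pre d \<delta> A)"

definition hausdorff_measure :: "nat \<Rightarrow> 'a::metric_space measure" where
  "hausdorff_measure d = measure_of UNIV (sets borel) (hausdorff_outer d)"

text \<open>
  The measure on the unit sphere; it is used with \<open>CARD('d) = n + 1\<close>. Its \<open>\<sigma>\<close>-algebra consists
  of the Borel subsets of the sphere. Covering diameters are Euclidean; chordal and geodesic
  distance yield the same Hausdorff measure.
\<close>

definition sphere_measure :: "nat \<Rightarrow> (real ^ 'd) measure" where
  "sphere_measure n = restrict_space (hausdorff_measure n) (sphere 0 1)"

definition geodesic_dist :: "real ^ 'd \<Rightarrow> real ^ 'd \<Rightarrow> real" where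
  "geodesic_dist x y = arccos (x \<bullet> y)"

definition spherical_cap :: "(real ^ 'd) set \<Rightarrow> bool" where
  "spherical_cap C \<longleftrightarrow>
     (\<exists>x \<in> sphere 0 1. \<exists>r \<ge> 0. C = {y \<in> sphere 0 1. geodesic_dist x y \<le> r})"

text \<open>
  A shortest geodesic from \<open>x\<close> to \<open>y\<close>, parametrised proportionally to arc length on
  the unit interval. It is unique if \<open>x \<noteq> - y\<close>, and then \<open>geodesic_segment x y\<close> is its image.
\<close>

definition shortest_geodesic :: "(real \<Rightarrow> real ^ 'd) \<Rightarrow> real ^ 'd \<Rightarrow> real ^ 'd \<Rightarrow> bool" where
  "shortest_geodesic \<gamma> x y \<longleftrightarrow>
     \<gamma> ` {0..1} \<subseteq> sphere 0 1 \<and> \<gamma> 0 = x \<and> \<gamma> 1 = y \<and>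
     (\<forall>s \<in> {0..1}. \<forall>t \<in> {0..1}. geodesic_dist (\<gamma> s) (\<gamma> t) = \<bar>s - t\<bar> * geodesic_dist x y)"

definition geodesic_segment :: "real ^ 'd \<Rightarrow> real ^ 'd \<Rightarrow> (real ^ 'd) set" where
  "geodesic_segment x y = (\<Union>\<gamma> \<in> {\<gamma>. shortest_geodesic \<gamma> x y}. \<gamma> ` {0..1})"

definition spherically_convex :: "(real ^ 'd) set \<Rightarrow> bool" where
  "spherically_convex K \<longleftrightarrow>
     K \<subseteq> sphere 0 1 \<and> (\<forall>x \<in> K. \<forall>y \<in> K. x \<noteq> - y \<longrightarrow> geodesic_segment x y \<subseteq> K)"

definition spherical_hull :: "(real ^ 'd) set \<Rightarrow> (real ^ 'd) set" where
  "spherical_hull K = \<Inter> {C. spherically_convex C \<and> K \<subseteq> C}"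

definition proper_subset :: "(real ^ 'd) set \<Rightarrow> bool" where
  "proper_subset K \<longleftrightarrow> (\<exists>u \<in> sphere 0 1. K \<subseteq> {x \<in> sphere 0 1. 0 < u \<bullet> x})"

definition spherical_polar :: "(real ^ 'd) set \<Rightarrow> (real ^ 'd) set" where
  "spherical_polar K = {x \<in> sphere 0 1. \<forall>y \<in> K. x \<bullet> y \<le> 0}"

definition independent_uniform_points ::
    "nat \<Rightarrow> (real ^ 'd) set \<Rightarrow> nat \<Rightarrow> 'p measure \<Rightarrow> (nat \<Rightarrow> 'p \<Rightarrow> real ^ 'd) \<Rightarrow> bool" where
  "independent_uniform_points n L N P X \<longleftrightarrow>
     prob_space P \<and>
     prob_space.indep_vars P (\<lambda>_. sphere_measure n) X {1..N} \<and>
     (\<forall>i \<in> {1..N}. distr P (sphere_measure n) (X i) = uniform_measure (sphere_measure n) L)"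

definition random_hull :: "(nat \<Rightarrow> 'p \<Rightarrow> real ^ 'd) \<Rightarrow> nat \<Rightarrow> 'p \<Rightarrow> (real ^ 'd) set" where
  "random_hull X N \<omega> = spherical_hull ((\<lambda>i. X i \<omega>) ` {1..N})"

end

theory Submission imports Defs begin

text \<open>
  Let \<open>\<mu>\<close> be the measure on the sphere, and let \<open>T A x\<close> be the measure of the part of \<open>A\<close> in the
  closed hemisphere opposite to \<open>x\<close>. A point \<open>x\<close> belongs to the polar set of the random hull iff
  all random points lie in that hemisphere. By Fubini's theorem and independence, the expectation
  for points in \<open>K\<close> is the integral of \<open>(T K x / \<mu> K) ^ N\<close> over \<open>x\<close>. So it has to be shown that, among
  all sets of given measure, the energy, which is the integral of \<open>T A x ^ N\<close> over \<open>x\<close>, is largest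
  for a cap.

  This is a Riesz-type rearrangement inequality, proved by polarization (two-point symmetrization).
  For a mirror hyperplane, polarization moves a point of \<open>A\<close> to its mirror image, on a chosen side,
  if the image was not in \<open>A\<close>. On every mirror pair \<open>x\<close>, \<open>x'\<close> this preserves \<open>T A x + T A x'\<close> but
  spreads the two values apart, so by convexity of the \<open>N\<close>-th power the energy does not decrease
  (\<open>halfspace_energy_polarization\<close>).

  It remains to approach the cap \<open>C\<close> by polarizations. Let \<open>\<delta>\<close> be the measure of \<open>A - C\<close>, which is
  also that of \<open>C - A\<close>. If the mirror images of some points of \<open>A - C\<close> lie in \<open>C - A\<close>, polarization
  moves these points into the cap. For a fixed point, the image in a random mirror is sufficiently
  spread out over the sphere, so that on average at least a fixed multiple of \<open>\<delta>\<^sup>2\<close> is moved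
  (\<open>exists_polarization_gain\<close>). Hence \<open>\<delta>\<close> can be made arbitrarily small
  (\<open>polarizations_approach_cap\<close>), and the energy depends continuously on the set
  (\<open>halfspace_energy_le_add\<close>).

  The spreading of the mirror images comes from the definition of Hausdorff measure: for a fixed
  point \<open>y\<close>, the map from the unit normal of a mirror to the mirror image of \<open>y\<close> is Lipschitz.
\<close>

section \<open>Hausdorff measure and Lipschitz maps\<close>

text \<open>
  The images of the sets of a cover of \<open>A\<close>, cut down to \<open>A\<close>, cover the image, and each diameter
  grows at most by the factor \<open>L\<close>.
\<close>

lemma hausdorff_pre_Lipschitz_image:
  fixes f :: "'a::metric_space \<Rightarrow> 'b::metric_space"
  assumes L: "0 < L" and lip: "L-lipschitz_on A f"
  shows "hausdorff_pre d (L * \<delta>) (f ` A) \<le> hausdorff_pre d \<delta> A * ennreal (L ^ d)"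
proof -
  let ?w = "\<lambda>U. if U = {} then 0 else ennreal (unit_ball_vol (real d) * (diameter U / 2) ^ d)"
  have dist_f: "dist (f x) (f y) \<le> L * dist x y" if "x \<in> A" "y \<in> A" for x y
    using lip that by (rule lipschitz_onD)
  have "hausdorff_pre d (L * \<delta>) (f ` A) / ennreal (L ^ d) \<le> hausdorff_pre d \<delta> A"
    unfolding hausdorff_pre_def[of d \<delta> A]
  proof (rule INF_greatest)
    fix U :: "nat \<Rightarrow> 'a set"
    assume "U \<in> {U. A \<subseteq> (\<Union>i. U i) \<and> (\<forall>i. bounded (U i) \<and> diameter (U i) \<le> \<delta>)}"
    then have cover: "A \<subseteq> (\<Union>i. U i)" and bdd: "\<And>i. bounded (U i)"
      and diam: "\<And>i. diameter (U i) \<le> \<delta>"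
      by auto
    define V where "V i = f ` (U i \<inter> A)" for i
    have dist_V: "dist x y \<le> L * diameter (U i)" if "x \<in> V i" "y \<in> V i" for x y i
    proof -
      from that obtain a b where ab: "x = f a" "y = f b" "a \<in> U i" "a \<in> A" "b \<in> U i" "b \<in> A"
        by (auto simp: V_def)
      have "dist x y \<le> L * dist a b"
        using ab dist_f by simp
      also have "\<dots> \<le> L * diameter (U i)"
        using L ab bdd by (intro mult_left_mono diameter_bounded_bound) auto
      finally show ?thesis .
    qed
    have bdd_V: "bounded (V i)" for i
      unfolding bounded_two_points using dist_V by blast
    have diam_V: "diameter (V i) \<le> L * diameter (U i)" for i
    proof (cases "V i = {}")
      case True
      then show ?thesis using L diameter_ge_0[OF bdd] by simp
    next
      case False
      then have "diameter (V i) = (SUP (x, y) \<in> V i \<times> V i. dist x y)"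
        by (simp add: diameter_def)
      also have "\<dots> \<le> L * diameter (U i)"
        using False dist_V[of _ i] by (intro cSUP_least) auto
      finally show ?thesis .
    qed
    have "hausdorff_pre d (L * \<delta>) (f ` A) \<le> (\<Sum>i. ?w (V i))"
      unfolding hausdorff_pre_def
    proof (rule INF_lower, intro CollectI conjI allI)
      show "f ` A \<subseteq> (\<Union>i. V i)"
        using cover unfolding V_def by blast
      show "bounded (V i)" for i by (rule bdd_V)
      show "diameter (V i) \<le> L * \<delta>" for i
        using diam_V[of i] diam[of i] L by (meson mult_left_mono less_imp_le order_trans)
    qed
    also have "\<dots> \<le> (\<Sum>i. ?w (U i) * ennreal (L ^ d))"
    proof (rule suminf_le)
      fix i
      have "ennreal (unit_ball_vol (real d) * (diameter (V i) / 2) ^ d)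
          \<le> ennreal (unit_ball_vol (real d) * (diameter (U i) / 2) ^ d) * ennreal (L ^ d)"
      proof -
        have "unit_ball_vol (real d) * (diameter (V i) / 2) ^ d
            \<le> unit_ball_vol (real d) * (L * diameter (U i) / 2) ^ d"
          using diam_V[of i] diameter_ge_0[OF bdd_V]
          by (intro mult_left_mono power_mono) auto
        also have "\<dots> = (unit_ball_vol (real d) * (diameter (U i) / 2) ^ d) * L ^ d"
          by (simp add: power_mult_distrib power_divide)
        finally show ?thesis
          using L diameter_ge_0[OF bdd, of i] by (simp add: ennreal_mult[symmetric])
      qed
      then show "?w (V i) \<le> ?w (U i) * ennreal (L ^ d)"
        by (auto simp: V_def)
    qed auto
    also have "\<dots> = (\<Sum>i. ?w (U i)) * ennreal (L ^ d)"
      by (rule ennreal_suminf_multc)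
    finally show "hausdorff_pre d (L * \<delta>) (f ` A) / ennreal (L ^ d) \<le> (\<Sum>i. ?w (U i))"
      using L by (intro divide_le_posI_ennreal) (auto simp: mult.commute)
  qed
  then have "hausdorff_pre d (L * \<delta>) (f ` A) / ennreal (L ^ d) * ennreal (L ^ d)
      \<le> hausdorff_pre d \<delta> A * ennreal (L ^ d)"
    by (rule mult_right_mono) simp
  then show ?thesis
    using L by (simp add: ennreal_divide_times ennreal_mult_divide_eq)
qed

lemma hausdorff_outer_Lipschitz_image:
  fixes f :: "'a::metric_space \<Rightarrow> 'b::metric_space"
  assumes L: "0 < L" and lip: "L-lipschitz_on A f"
  shows "hausdorff_outer d (f ` A) \<le> hausdorff_outer d A * ennreal (L ^ d)"
  unfolding hausdorff_outer_def[of d "f ` A"]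
proof (rule SUP_least)
  fix \<delta> :: real
  assume "\<delta> \<in> {0<..}"
  then have "hausdorff_pre d \<delta> (f ` A) = hausdorff_pre d (L * (\<delta> / L)) (f ` A)"
    using L by simp
  also have "\<dots> \<le> hausdorff_pre d (\<delta> / L) A * ennreal (L ^ d)"
    using assms by (rule hausdorff_pre_Lipschitz_image)
  also have "\<dots> \<le> hausdorff_outer d A * ennreal (L ^ d)"
    unfolding hausdorff_outer_def using L \<open>\<delta> \<in> {0<..}\<close>
    by (intro mult_right_mono SUP_upper) auto
  finally show "hausdorff_pre d \<delta> (f ` A) \<le> hausdorff_outer d A * ennreal (L ^ d)" .
qed

lemma hausdorff_outer_singleton:
  assumes "d \<ge> 1"
  shows "hausdorff_outer d {x} = 0"
proof -
  have "hausdorff_pre d \<delta> {x} \<le> 0" if "\<delta> > 0" for \<delta>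
    unfolding hausdorff_pre_def
    using that assms
    by (intro INF_lower2[of "\<lambda>_. {x}"]) (auto simp: power_0_left)
  then show ?thesis
    unfolding hausdorff_outer_def by (auto intro!: antisym SUP_least)
qed

section \<open>Reflections in hyperplanes through the origin\<close>

definition hyperplane_reflection :: "'a::real_inner \<Rightarrow> 'a \<Rightarrow> 'a" where
  "hyperplane_reflection u x = x - (2 * (u \<bullet> x)) *\<^sub>R u"

lemma inner_hyperplane_reflection:
  "x \<bullet> hyperplane_reflection u y = x \<bullet> y - 2 * (u \<bullet> y) * (u \<bullet> x)"
  by (simp add: hyperplane_reflection_def inner_diff_right inner_commute)

lemma inner_normal_hyperplane_reflection:
  "norm u = 1 \<Longrightarrow> u \<bullet> hyperplane_reflection u y = - (u \<bullet> y)"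
  by (simp add: inner_hyperplane_reflection dot_square_norm)

lemma hyperplane_reflection_involutive [simp]:
  "norm u = 1 \<Longrightarrow> hyperplane_reflection u (hyperplane_reflection u x) = x"
  by (simp add: hyperplane_reflection_def[of u "hyperplane_reflection u x"]
      inner_normal_hyperplane_reflection) (simp add: hyperplane_reflection_def)

lemma inner_hyperplane_reflection_swap:
  "hyperplane_reflection u x \<bullet> y = x \<bullet> hyperplane_reflection u y"
  by (metis inner_hyperplane_reflection inner_commute mult.commute mult.left_commute)

lemma norm_hyperplane_reflection [simp]:
  "norm u = 1 \<Longrightarrow> norm (hyperplane_reflection u x) = norm x"
  by (simp add: norm_eq_sqrt_inner inner_hyperplane_reflection_swap)

lemma hyperplane_reflection_minus_normal [simp]:
  "hyperplane_reflection (- u) = hyperplane_reflection u"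
  by (auto simp: hyperplane_reflection_def)

lemma hyperplane_reflection_diff:
  "hyperplane_reflection u x - hyperplane_reflection u y = hyperplane_reflection u (x - y)"
  by (simp add: hyperplane_reflection_def algebra_simps inner_diff_right)

lemma lipschitz_hyperplane_reflection:
  "norm u = 1 \<Longrightarrow> 1-lipschitz_on A (hyperplane_reflection u)"
  by (rule lipschitz_onI) (simp_all add: dist_norm hyperplane_reflection_diff)

lemma borel_measurable_hyperplane_reflection [measurable]:
  fixes f g :: "'b \<Rightarrow> 'a::euclidean_space"
  assumes [measurable]: "f \<in> borel_measurable M" "g \<in> borel_measurable M"
  shows "(\<lambda>x. hyperplane_reflection (f x) (g x)) \<in> borel_measurable M"
  unfolding hyperplane_reflection_def by measurable

text \<open>
  For fixed \<open>y\<close>, the map from mirrors to mirror images of \<open>y\<close> expands distances by a bounded factor,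
  and every point of the sphere other than \<open>y\<close> is such an image (\<open>reflection_exchange\<close> below).
  Hausdorff measure then shows that a random mirror sends \<open>y\<close> into a given set with a probability
  at least proportional to the measure of that set.
\<close>

lemma lipschitz_reflection_in_normal:
  fixes y :: "'a::real_inner"
  assumes "norm y = 1"
  shows "4-lipschitz_on (sphere 0 1) (\<lambda>u. hyperplane_reflection u y)"
proof (rule lipschitz_onI)
  fix u v :: 'a
  assume "u \<in> sphere 0 1" "v \<in> sphere 0 1"
  then have [simp]: "norm u = 1" "norm v = 1" by auto
  have "hyperplane_reflection u y - hyperplane_reflection v y
      = 2 *\<^sub>R ((v \<bullet> y) *\<^sub>R (v - u) + ((v - u) \<bullet> y) *\<^sub>R u)"
    by (simp add: hyperplane_reflection_def algebra_simps inner_diff_left scaleR_left_diff_distrib)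
  moreover have "norm ((v \<bullet> y) *\<^sub>R (v - u) + ((v - u) \<bullet> y) *\<^sub>R u)
      \<le> \<bar>v \<bullet> y\<bar> * norm (v - u) + \<bar>(v - u) \<bullet> y\<bar> * norm u"
    by (rule norm_triangle_le) simp
  moreover have "\<bar>v \<bullet> y\<bar> \<le> 1" "\<bar>(v - u) \<bullet> y\<bar> \<le> norm (v - u)"
    using Cauchy_Schwarz_ineq2[of v y] Cauchy_Schwarz_ineq2[of "v - u" y] assms by auto
  moreover have "\<bar>v \<bullet> y\<bar> * norm (v - u) \<le> norm (v - u)"
    using \<open>\<bar>v \<bullet> y\<bar> \<le> 1\<close> by (simp add: mult_left_le_one_le)
  ultimately show "dist (hyperplane_reflection u y) (hyperplane_reflection v y) \<le> 4 * dist u v"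
    by (simp add: dist_norm norm_minus_commute)
qed simp

lemma reflection_exchange:
  fixes y z :: "'a::real_inner"
  assumes "norm y = 1" "norm z = 1" "z \<noteq> y"
  shows "hyperplane_reflection ((y - z) /\<^sub>R norm (y - z)) y = z"
proof -
  have sq: "(norm (y - z))\<^sup>2 = 2 * ((y - z) \<bullet> y)"
    using assms dot_norm_neg[of y z]
    by (simp add: inner_diff_left inner_commute[of z y] dot_square_norm)
  have formula: "hyperplane_reflection (d /\<^sub>R norm d) y = y - (2 * (d \<bullet> y) / (norm d)\<^sup>2) *\<^sub>R d"
    for d
    by (simp add: hyperplane_reflection_def power2_eq_square divide_inverse mult_ac)
  have one: "2 * ((y - z) \<bullet> y) / (norm (y - z))\<^sup>2 = 1"
    unfolding sq[symmetric] using assms by simp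
  show ?thesis
    unfolding formula one by simp
qed

section \<open>Two inequalities for powers\<close>

text \<open>
  Convexity of the power function: of two pairs of numbers with equal sums, the wider one has the
  larger sum of powers.
\<close>

lemma sum_powers_le_of_spread:
  fixes c s t :: real
  assumes "0 \<le> c" "0 \<le> s" "0 \<le> t"
  shows "(c + s) ^ N + (c + t) ^ N \<le> c ^ N + (c + s + t) ^ N"
proof (induction N)
  case (Suc N)
  have "(c + s) ^ N \<le> (c + s + t) ^ N" "(c + t) ^ N \<le> (c + s + t) ^ N"
    using assms by (auto intro!: power_mono)
  then have "s * (c + s) ^ N \<le> s * (c + s + t) ^ N" "t * (c + t) ^ N \<le> t * (c + s + t) ^ N"
    using assms by (auto intro!: mult_left_mono)
  moreover have "c * ((c + s) ^ N + (c + t) ^ N) \<le> c * (c ^ N + (c + s + t) ^ N)"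
    using Suc assms by (intro mult_left_mono) auto
  ultimately show ?case
    by (simp add: algebra_simps)
qed simp

text \<open>
  The power function is Lipschitz on bounded intervals. The crude constant \<open>N * R ^ N\<close>, instead of
  \<open>N * R ^ (N - 1)\<close>, saves a case distinction for \<open>N = 0\<close>.
\<close>

lemma power_add_le_linear:
  fixes t \<delta> R :: real
  assumes "0 \<le> t" "0 \<le> \<delta>" "t + \<delta> \<le> R" "1 \<le> R"
  shows "(t + \<delta>) ^ N \<le> t ^ N + \<delta> * (real N * R ^ N)"
proof (induction N)
  case (Suc N)
  have "t * (t + \<delta>) ^ N \<le> t * (t ^ N + \<delta> * (real N * R ^ N))"
    using Suc assms by (intro mult_left_mono) auto
  moreover have "t * (\<delta> * (real N * R ^ N)) \<le> R * (\<delta> * (real N * R ^ N))"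
    using assms by (intro mult_right_mono) auto
  moreover have "\<delta> * (t + \<delta>) ^ N \<le> \<delta> * R ^ Suc N"
  proof -
    have "(t + \<delta>) ^ N \<le> R ^ N"
      using assms by (intro power_mono) auto
    also have "\<dots> \<le> R ^ Suc N"
      using assms by (intro power_increasing) auto
    finally show ?thesis
      using assms by (intro mult_left_mono) auto
  qed
  ultimately show ?case
    by (simp add: algebra_simps)
qed simp

section \<open>Polarization and the energy of a set\<close>

text \<open>
  Two-point rearrangement with respect to the mirror orthogonal to \<open>u\<close>: if exactly one point of a
  mirror pair belongs to \<open>A\<close>, it is moved to the side into which \<open>u\<close> points.
\<close>

definition polarization :: "'a::real_inner \<Rightarrow> 'a set \<Rightarrow> 'a set" where
  "polarization u A =
     {x. x \<in> A \<and> hyperplane_reflection u x \<in> A \<or>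
         0 < u \<bullet> x \<and> (x \<in> A \<or> hyperplane_reflection u x \<in> A)}"

text \<open>
  On the sphere, a larger inner product with \<open>p\<close> means a smaller distance to \<open>p\<close>. In this form, the
  property directly decides whether the mirror image of a point of \<open>C\<close> stays in \<open>C\<close>.
\<close>

definition cap_centered_at :: "'a::real_inner \<Rightarrow> 'a set \<Rightarrow> bool" where
  "cap_centered_at p C \<longleftrightarrow> (\<forall>y\<in>C. \<forall>z. norm z = 1 \<longrightarrow> p \<bullet> y \<le> p \<bullet> z \<longrightarrow> z \<in> C)"

text \<open>
  The rearrangement argument sees the measure on the sphere only through its finiteness, its
  invariance under reflections and the bound \<open>reflection_spread\<close>. The last one says that the
  mirror image of a fixed point in a random mirror is spread out: it hits \<open>B\<close> with a probability
  at least proportional to the measure of \<open>B\<close>.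
\<close>

locale reflection_invariant_sphere_measure = finite_measure M
  for M :: "'a::euclidean_space measure" and b :: real +
  assumes sets_eq_borel_sphere: "sets M = sets (restrict_space borel (sphere 0 1))"
    and emeasure_reflection:
      "norm u = 1 \<Longrightarrow> A \<in> sets M \<Longrightarrow>
         emeasure M {y \<in> sphere 0 1. hyperplane_reflection u y \<in> A} = emeasure M A"
    and spread_pos: "0 < b"
    and reflection_spread:
      "norm y = 1 \<Longrightarrow> B \<in> sets M \<Longrightarrow> y \<notin> B \<Longrightarrow>
         measure M B \<le> b * measure M {u \<in> sphere 0 1. hyperplane_reflection u y \<in> B}"
begin

lemma space_M: "space M = sphere 0 1"
  using sets_eq_imp_space_eq[OF sets_eq_borel_sphere] by (simp add: space_restrict_space)

lemma sets_M_iff: "A \<in> sets M \<longleftrightarrow> A \<in> sets borel \<and> A \<subseteq> sphere 0 1"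
  unfolding sets_eq_borel_sphere by (subst sets_restrict_space_iff) auto

lemma norm_of_mem: "A \<in> sets M \<Longrightarrow> x \<in> A \<Longrightarrow> norm x = 1"
  using sets_M_iff by auto

lemma borel_measurable_M: "f \<in> borel_measurable borel \<Longrightarrow> f \<in> borel_measurable M"
  unfolding measurable_cong_sets[OF sets_eq_borel_sphere refl]
  by (rule measurable_restrict_space1)

lemma sets_halfspace_part: "A \<in> sets M \<Longrightarrow> {y \<in> A. x \<bullet> y \<le> 0} \<in> sets M"
proof -
  assume "A \<in> sets M"
  then have [measurable]: "A \<in> sets borel" and "A \<subseteq> sphere 0 1" by (auto simp: sets_M_iff)
  moreover have "{y \<in> A. x \<bullet> y \<le> 0} \<in> sets borel" by measurable
  ultimately show ?thesis by (auto simp: sets_M_iff)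
qed

lemma sets_reflection:
  assumes "A \<in> sets M"
  shows "{y \<in> sphere 0 1. hyperplane_reflection u y \<in> A} \<in> sets M"
proof -
  have [measurable]: "A \<in> sets borel" using assms by (auto simp: sets_M_iff)
  have "{y \<in> sphere 0 1. hyperplane_reflection u y \<in> A} \<in> sets borel" by measurable
  then show ?thesis by (auto simp: sets_M_iff)
qed

lemma measure_reflection:
  "norm u = 1 \<Longrightarrow> A \<in> sets M \<Longrightarrow>
     measure M {y \<in> sphere 0 1. hyperplane_reflection u y \<in> A} = measure M A"
  by (simp only: measure_def emeasure_reflection)

lemma sets_polarization:
  assumes "norm u = 1" "A \<in> sets M"
  shows "polarization u A \<in> sets M"
proof -
  have [measurable]: "A \<in> sets borel" using assms by (auto simp: sets_M_iff)
  have "polarization u A \<in> sets borel" unfolding polarization_def by measurable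
  moreover have "norm x = 1" if "x \<in> polarization u A" for x
  proof -
    have "x \<in> A \<or> hyperplane_reflection u x \<in> A"
      using that by (auto simp: polarization_def)
    then show ?thesis
      using norm_of_mem[OF assms(2)] norm_hyperplane_reflection[OF assms(1), of x] by metis
  qed
  ultimately show ?thesis by (auto simp: sets_M_iff)
qed

text \<open>
  The comparison behind all estimates for a single polarization: the points that \<open>X\<close> has in excess
  of \<open>Y\<close> are mirrored injectively into the points that \<open>Y\<close> has in excess of \<open>X\<close>.
\<close>

lemma measure_le_by_reflection:
  assumes u: "norm u = 1" and X: "X \<in> sets M" and Y: "Y \<in> sets M"
    and swap: "\<And>y. y \<in> X \<Longrightarrow> y \<notin> Y \<Longrightarrow>
      hyperplane_reflection u y \<in> Y \<and> hyperplane_reflection u y \<notin> X"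
  shows "measure M X \<le> measure M Y"
proof -
  have "measure M (X - Y) \<le> measure M {y \<in> sphere 0 1. hyperplane_reflection u y \<in> Y - X}"
    using swap norm_of_mem[OF X] X Y by (intro finite_measure_mono sets_reflection) auto
  also have "\<dots> = measure M (Y - X)"
    using u X Y by (intro measure_reflection) auto
  finally show ?thesis
    using finite_measure_Diff'[OF X Y] finite_measure_Diff'[OF Y X] by (simp add: Int_commute)
qed

text \<open>
  For a uniform random point in \<open>A\<close>, this is, up to the factor \<open>measure M A\<close>, the probability that
  the polar set of the point contains \<open>x\<close>.
\<close>

definition halfspace_mass :: "'a set \<Rightarrow> 'a \<Rightarrow> real" where
  "halfspace_mass A x = measure M {y \<in> A. x \<bullet> y \<le> 0}"

lemma halfspace_mass_nonneg: "0 \<le> halfspace_mass A x"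
  by (simp add: halfspace_mass_def)

lemma halfspace_mass_le: "halfspace_mass A x \<le> measure M (space M)"
  unfolding halfspace_mass_def by (rule bounded_measure)

lemma borel_measurable_projections [measurable]:
  "fst \<in> borel_measurable (M \<Otimes>\<^sub>M M)" "snd \<in> borel_measurable (M \<Otimes>\<^sub>M M)"
  using measurable_compose[OF measurable_fst borel_measurable_M[of "\<lambda>x. x"]]
    measurable_compose[OF measurable_snd borel_measurable_M[of "\<lambda>x. x"]]
  by simp_all

lemma sets_pair_reflection:
  assumes "A \<in> sets M" "B \<in> sets M"
  shows "{z \<in> space (M \<Otimes>\<^sub>M M). snd z \<in> A \<and> hyperplane_reflection (fst z) (snd z) \<in> B}
    \<in> sets (M \<Otimes>\<^sub>M M)"
proof -
  have [measurable]: "A \<in> sets borel" "B \<in> sets borel"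
    using assms by (auto simp: sets_M_iff)
  show ?thesis by measurable
qed

lemma sets_pair_halfspace:
  assumes "A \<in> sets M"
  shows "{z \<in> space (M \<Otimes>\<^sub>M M). snd z \<in> A \<and> fst z \<bullet> snd z \<le> 0} \<in> sets (M \<Otimes>\<^sub>M M)"
proof -
  have [measurable]: "A \<in> sets borel"
    using assms by (auto simp: sets_M_iff)
  show ?thesis by measurable
qed

lemma measurable_halfspace_mass:
  assumes "A \<in> sets M"
  shows "halfspace_mass A \<in> borel_measurable M"
proof -
  let ?E = "{z \<in> space (M \<Otimes>\<^sub>M M). snd z \<in> A \<and> fst z \<bullet> snd z \<le> 0}"
  have "(\<lambda>x. enn2real (emeasure M (Pair x -` ?E))) \<in> borel_measurable M"
    using measurable_emeasure_Pair[OF sets_pair_halfspace[OF assms]] by simp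
  moreover have "halfspace_mass A x = enn2real (emeasure M (Pair x -` ?E))" if "x \<in> space M" for x
  proof -
    have "Pair x -` ?E = {y \<in> A. x \<bullet> y \<le> 0}"
      using that sets.sets_into_space[OF assms] by (auto simp: space_pair_measure)
    then show ?thesis by (simp add: halfspace_mass_def measure_def)
  qed
  ultimately show ?thesis
    by (simp cong: measurable_cong)
qed

lemma integrable_halfspace_mass_power:
  assumes "A \<in> sets M"
  shows "integrable M (\<lambda>x. halfspace_mass A x ^ N)"
proof (rule integrable_const_bound)
  show "AE x in M. norm (halfspace_mass A x ^ N) \<le> measure M (space M) ^ N"
    by (simp add: halfspace_mass_nonneg halfspace_mass_le power_mono)
  show "(\<lambda>x. halfspace_mass A x ^ N) \<in> borel_measurable M"
    using measurable_halfspace_mass[OF assms] by measurable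
qed

lemma measurable_reflection: "norm u = 1 \<Longrightarrow> hyperplane_reflection u \<in> measurable M M"
  using sets_reflection
  by (intro measurableI) (auto simp: space_M vimage_def Int_def conj_commute)

lemma distr_reflection:
  assumes "norm u = 1"
  shows "distr M M (hyperplane_reflection u) = M"
proof (rule measure_eqI)
  fix A assume "A \<in> sets (distr M M (hyperplane_reflection u))"
  then have A: "A \<in> sets M" by simp
  have "hyperplane_reflection u -` A \<inter> space M = {y \<in> sphere 0 1. hyperplane_reflection u y \<in> A}"
    by (auto simp: space_M)
  then show "emeasure (distr M M (hyperplane_reflection u)) A = emeasure M A"
    using assms A emeasure_distr[OF measurable_reflection A] emeasure_reflection by simp
qed simp

lemma halfspace_mass_reflection:
  assumes u: "norm u = 1" and A: "A \<in> sets M"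
  shows "halfspace_mass A (hyperplane_reflection u x)
    = halfspace_mass {y \<in> sphere 0 1. hyperplane_reflection u y \<in> A} x"
proof -
  have "{y \<in> sphere 0 1. hyperplane_reflection u y \<in> {y \<in> A. hyperplane_reflection u x \<bullet> y \<le> 0}}
      = {y \<in> {y \<in> sphere 0 1. hyperplane_reflection u y \<in> A}. x \<bullet> y \<le> 0}"
    using u by (auto simp: inner_hyperplane_reflection_swap)
  then show ?thesis
    unfolding halfspace_mass_def
    using measure_reflection[OF u sets_halfspace_part[OF A], of "hyperplane_reflection u x"] by simp
qed

text \<open>
  Polarization moves mass to the side of \<open>u\<close>. If \<open>x\<close> lies on that side, a moved point comes closer
  to \<open>x\<close>, so mass can only leave the hemisphere opposite to \<open>x\<close>.
\<close>

lemma halfspace_mass_polarization_le: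
  assumes u: "norm u = 1" and A: "A \<in> sets M" and x: "0 \<le> u \<bullet> x"
  shows "halfspace_mass (polarization u A) x \<le> halfspace_mass A x"
  unfolding halfspace_mass_def
proof (rule measure_le_by_reflection[OF u])
  fix y
  assume "y \<in> {y \<in> polarization u A. x \<bullet> y \<le> 0}" "y \<notin> {y \<in> A. x \<bullet> y \<le> 0}"
  then have y: "0 < u \<bullet> y" "y \<notin> A" "hyperplane_reflection u y \<in> A" "x \<bullet> y \<le> 0"
    by (auto simp: polarization_def)
  moreover have "0 \<le> 2 * (u \<bullet> y) * (u \<bullet> x)"
    using y(1) x by simp
  then have "x \<bullet> hyperplane_reflection u y \<le> 0"
    unfolding inner_hyperplane_reflection using y(4) by linarith
  ultimately show "hyperplane_reflection u y \<in> {y \<in> A. x \<bullet> y \<le> 0} \<and>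
      hyperplane_reflection u y \<notin> {y \<in> polarization u A. x \<bullet> y \<le> 0}"
    using u by (auto simp: polarization_def inner_normal_hyperplane_reflection)
qed (use assms in \<open>auto intro!: sets_halfspace_part sets_polarization\<close>)

lemma polarization_reflection:
  assumes "norm u = 1" "A \<in> sets M"
  shows "polarization u {y \<in> sphere 0 1. hyperplane_reflection u y \<in> A} = polarization u A"
proof -
  have "norm x = 1" if "x \<in> A \<or> hyperplane_reflection u x \<in> A" for x
    using that norm_of_mem[OF assms(2)] norm_hyperplane_reflection[OF assms(1), of x] by metis
  then show ?thesis
    unfolding polarization_def using assms(1) by auto
qed

text \<open>
  A set and its mirror image have the same union and the same intersection as the polarized set
  and its mirror image, because polarization only decides which point of a mirror pair is used.
  Cutting with \<open>H\<close> yields both conservation of measure and conservation of the sum of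
  \<open>halfspace_mass\<close> over a mirror pair.
\<close>

lemma measure_polarization_pair:
  assumes u: "norm u = 1" and A: "A \<in> sets M"
    and A': "A' = {y \<in> sphere 0 1. hyperplane_reflection u y \<in> A}"
    and R: "R = {y \<in> sphere 0 1. hyperplane_reflection u y \<in> polarization u A}"
    and H: "\<And>X. X \<in> sets M \<Longrightarrow> X \<inter> H \<in> sets M"
  shows "measure M (polarization u A \<inter> H) + measure M (R \<inter> H)
       = measure M (A \<inter> H) + measure M (A' \<inter> H)"
proof -
  let ?P = "polarization u A"
  have P: "?P \<in> sets M" by (rule sets_polarization[OF u A])
  have S: "R \<in> sets M" "A' \<in> sets M"
    unfolding R A' by (rule sets_reflection[OF P] sets_reflection[OF A])+
  have modular: "measure M (X \<inter> H) + measure M (Y \<inter> H)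
      = measure M ((X \<union> Y) \<inter> H) + measure M ((X \<inter> Y) \<inter> H)"
    if "X \<in> sets M" "Y \<in> sets M" for X Y
  proof -
    have "measure M (X \<inter> H \<union> Y \<inter> H) = measure M (X \<inter> H) + measure M (Y \<inter> H - X \<inter> H)"
      using that H by (intro finite_measure_Union') auto
    moreover have "measure M (Y \<inter> H - X \<inter> H) = measure M (Y \<inter> H) - measure M ((Y \<inter> H) \<inter> (X \<inter> H))"
      using that H by (intro finite_measure_Diff') auto
    moreover have "X \<inter> H \<union> Y \<inter> H = (X \<union> Y) \<inter> H" "(Y \<inter> H) \<inter> (X \<inter> H) = (X \<inter> Y) \<inter> H"
      by auto
    ultimately show ?thesis by simp
  qed
  have nA: "norm x = 1" if "x \<in> A" for x by (rule norm_of_mem[OF A that])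
  have nP: "norm x = 1" if "x \<in> ?P" for x by (rule norm_of_mem[OF P that])
  have fixed: "hyperplane_reflection u x = x" if "u \<bullet> x = 0" for x
    using that by (simp add: hyperplane_reflection_def)
  have nr: "norm x = 1" if "hyperplane_reflection u x \<in> A" for x
    using nA[OF that] u by simp
  have "?P \<union> R = A \<union> A'" "?P \<inter> R = A \<inter> A'"
  proof -
    have "x \<in> ?P \<union> R \<longleftrightarrow> x \<in> A \<union> A'" "x \<in> ?P \<inter> R \<longleftrightarrow> x \<in> A \<inter> A'" for x
      using u nA[of x] nr[of x] fixed[of x] unfolding R A' polarization_def
      by (cases "u \<bullet> x" "0::real" rule: linorder_cases;
          auto simp: inner_normal_hyperplane_reflection)+
    then show "?P \<union> R = A \<union> A'" "?P \<inter> R = A \<inter> A'" by blast+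
  qed
  then show ?thesis
    using modular[OF P S(1)] modular[OF A S(2)] by simp
qed

lemma measure_polarization:
  assumes u: "norm u = 1" and A: "A \<in> sets M"
  shows "measure M (polarization u A) = measure M A"
  using measure_polarization_pair[OF u A refl refl, of UNIV]
    measure_reflection[OF u A] measure_reflection[OF u sets_polarization[OF u A]]
  by simp

lemma halfspace_mass_polarization_sum:
  assumes u: "norm u = 1" and A: "A \<in> sets M"
  shows "halfspace_mass (polarization u A) x
        + halfspace_mass (polarization u A) (hyperplane_reflection u x)
      = halfspace_mass A x + halfspace_mass A (hyperplane_reflection u x)"
proof -
  have "X \<inter> {y. x \<bullet> y \<le> 0} = {y \<in> X. x \<bullet> y \<le> 0}" for X by auto
  then show ?thesis
    using measure_polarization_pair[OF u A refl refl, of "{y. x \<bullet> y \<le> 0}"] sets_halfspace_part[of _ x]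
      halfspace_mass_reflection[OF u A, of x]
      halfspace_mass_reflection[OF u sets_polarization[OF u A], of x]
    by (simp add: halfspace_mass_def)
qed

text \<open>
  On a mirror pair polarization keeps the sum of the two values of \<open>halfspace_mass\<close> and makes the
  value on the side of \<open>u\<close> at most the smaller of the two, so the pair of values becomes wider.
\<close>

lemma polarization_power_sum_mono:
  assumes u: "norm u = 1" and A: "A \<in> sets M"
  shows "halfspace_mass A x ^ N + halfspace_mass A (hyperplane_reflection u x) ^ N
      \<le> halfspace_mass (polarization u A) x ^ N
        + halfspace_mass (polarization u A) (hyperplane_reflection u x) ^ N"
proof -
  have main: "halfspace_mass A x ^ N + halfspace_mass A (hyperplane_reflection u x) ^ N
      \<le> halfspace_mass (polarization u A) x ^ N
        + halfspace_mass (polarization u A) (hyperplane_reflection u x) ^ N"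
    if x: "0 \<le> u \<bullet> x" for x
  proof -
    define c s t where "c = halfspace_mass (polarization u A) x"
      and "s = halfspace_mass A x - c"
      and "t = halfspace_mass A (hyperplane_reflection u x) - c"
    have "0 \<le> c" by (simp add: c_def halfspace_mass_nonneg)
    moreover have "0 \<le> s"
      using halfspace_mass_polarization_le[OF u A x] by (simp add: s_def c_def)
    moreover have "0 \<le> t"
      using halfspace_mass_polarization_le[OF u sets_reflection[OF A, of u] x]
        halfspace_mass_reflection[OF u A, of x] polarization_reflection[OF u A]
      by (simp add: t_def c_def)
    ultimately have "(c + s) ^ N + (c + t) ^ N \<le> c ^ N + (c + s + t) ^ N"
      by (rule sum_powers_le_of_spread)
    moreover have "c + s + t = halfspace_mass (polarization u A) (hyperplane_reflection u x)"
      using halfspace_mass_polarization_sum[OF u A, of x] by (simp add: s_def t_def c_def)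
    ultimately show ?thesis
      by (simp add: s_def t_def c_def)
  qed
  show ?thesis
  proof (cases "0 \<le> u \<bullet> x")
    case False
    then have "0 \<le> u \<bullet> hyperplane_reflection u x"
      using u by (simp add: inner_normal_hyperplane_reflection)
    from main[OF this] show ?thesis using u by simp
  qed (rule main)
qed

definition halfspace_energy :: "nat \<Rightarrow> 'a set \<Rightarrow> real" where
  "halfspace_energy N A = (\<integral>x. halfspace_mass A x ^ N \<partial>M)"

text \<open>
  By reflection invariance, the integral may be symmetrized over mirror pairs, where
  \<open>polarization_power_sum_mono\<close> applies pointwise.
\<close>

lemma halfspace_energy_polarization:
  assumes u: "norm u = 1" and A: "A \<in> sets M"
  shows "halfspace_energy N A \<le> halfspace_energy N (polarization u A)"
proof -
  have refl_meas: "hyperplane_reflection u \<in> measurable M M"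
    by (rule measurable_reflection[OF u])
  have double: "2 * halfspace_energy N B
      = (\<integral>x. halfspace_mass B x ^ N + halfspace_mass B (hyperplane_reflection u x) ^ N \<partial>M)"
    and int: "integrable M (\<lambda>x. halfspace_mass B x ^ N
        + halfspace_mass B (hyperplane_reflection u x) ^ N)" if B: "B \<in> sets M" for B
  proof -
    note I = integrable_halfspace_mass_power[OF B, of N]
    have I': "integrable M (\<lambda>x. halfspace_mass B (hyperplane_reflection u x) ^ N)"
      using integrable_distr[OF refl_meas, of "\<lambda>x. halfspace_mass B x ^ N"] I distr_reflection[OF u]
      by simp
    have "(\<integral>x. halfspace_mass B (hyperplane_reflection u x) ^ N \<partial>M) = halfspace_energy N B"
      using integral_distr[OF refl_meas borel_measurable_integrable[OF I]] distr_reflection[OF u]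
      by (simp add: halfspace_energy_def)
    then show "2 * halfspace_energy N B
      = (\<integral>x. halfspace_mass B x ^ N + halfspace_mass B (hyperplane_reflection u x) ^ N \<partial>M)"
      using I I' by (simp add: halfspace_energy_def)
    show "integrable M (\<lambda>x. halfspace_mass B x ^ N
        + halfspace_mass B (hyperplane_reflection u x) ^ N)"
      using I I' by simp
  qed
  have "2 * halfspace_energy N A \<le> 2 * halfspace_energy N (polarization u A)"
    unfolding double[OF A] double[OF sets_polarization[OF u A]]
    by (intro integral_mono int A sets_polarization u polarization_power_sum_mono)
  then show ?thesis by simp
qed

text \<open>
  If \<open>u\<close> points to the side of the centre \<open>p\<close>, no mass leaves the cap, and all mass of \<open>A\<close> outside the
  cap whose mirror image is a free place inside the cap is moved there.
\<close>

lemma polarization_toward_cap: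
  assumes u: "norm u = 1" and A: "A \<in> sets M" and C: "C \<in> sets M"
    and p: "0 \<le> u \<bullet> p"
    and cap: "cap_centered_at p C"
  shows "measure M (polarization u A - C)
      \<le> measure M (A - C) - measure M {y \<in> C - A. hyperplane_reflection u y \<in> A - C}"
proof -
  let ?P = "polarization u A"
  let ?G = "{y \<in> C - A. hyperplane_reflection u y \<in> A - C}"
  have P: "?P \<in> sets M" by (rule sets_polarization[OF u A])
  have "?G = (C - A) \<inter> {y \<in> sphere 0 1. hyperplane_reflection u y \<in> A - C}"
    using norm_of_mem[OF C] by auto
  then have G: "?G \<in> sets M"
    using sets.Diff[OF C A] sets_reflection[OF sets.Diff[OF A C]] by simp
  have "?G \<subseteq> ?P \<inter> C"
  proof safe
    fix y assume y: "y \<in> C" "y \<notin> A" "hyperplane_reflection u y \<in> A" "hyperplane_reflection u y \<notin> C"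
    then have "\<not> p \<bullet> y \<le> p \<bullet> hyperplane_reflection u y"
      using cap norm_of_mem[OF A] unfolding cap_centered_at_def by blast
    then have "0 < (u \<bullet> y) * (u \<bullet> p)"
      by (simp add: inner_hyperplane_reflection mult.commute)
    then have "0 < u \<bullet> y"
      using p by (simp add: zero_less_mult_iff)
    with y show "y \<in> ?P" by (simp add: polarization_def)
  qed
  have "measure M (A \<inter> C) \<le> measure M (?P \<inter> C - ?G)"
  proof (rule measure_le_by_reflection[OF u])
    fix y assume "y \<in> A \<inter> C" "y \<notin> ?P \<inter> C - ?G"
    then have y: "y \<in> A" "y \<in> C" "y \<notin> ?P" by auto
    then have r: "hyperplane_reflection u y \<notin> A" and "u \<bullet> y \<le> 0"
      by (auto simp: polarization_def)
    have "u \<bullet> y \<noteq> 0"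
      using y r by (auto simp: hyperplane_reflection_def)
    with \<open>u \<bullet> y \<le> 0\<close> have neg: "u \<bullet> y < 0" by simp
    have "p \<bullet> y \<le> p \<bullet> hyperplane_reflection u y"
      using neg p mult_nonneg_nonpos[of "u \<bullet> p" "u \<bullet> y"] by (simp add: inner_hyperplane_reflection)
    then have "hyperplane_reflection u y \<in> C"
      using cap y(2) u norm_of_mem[OF A y(1)] unfolding cap_centered_at_def by simp
    moreover have "hyperplane_reflection u y \<in> ?P"
      using neg y u by (simp add: polarization_def inner_normal_hyperplane_reflection)
    ultimately show "hyperplane_reflection u y \<in> ?P \<inter> C - ?G \<and> hyperplane_reflection u y \<notin> A \<inter> C"
      using y r u by auto
  qed (use A C P G in auto)
  also have "\<dots> = measure M (?P \<inter> C) - measure M ?G"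
    using P C G \<open>?G \<subseteq> ?P \<inter> C\<close> by (intro finite_measure_Diff) auto
  finally show ?thesis
    using finite_measure_Diff'[OF P C] finite_measure_Diff'[OF A C] measure_polarization[OF u A]
    by simp
qed

text \<open>
  By Fubini's theorem, the mass of points of \<open>A\<close> whose mirror image lies in \<open>B\<close> is on average over
  all mirrors at least \<open>measure M A * measure M B\<close> divided by \<open>b * measure M (space M)\<close>. Some mirror
  therefore achieves at least half of this average; the factor \<open>2\<close> keeps the comparison of integrals
  non-strict.
\<close>

lemma exists_reflection_exchanging_mass:
  assumes A: "A \<in> sets M" and B: "B \<in> sets M" and disj: "A \<inter> B = {}"
  shows "\<exists>u. norm u = 1 \<and> measure M A * measure M B
      \<le> 2 * b * measure M (space M) * measure M {y \<in> A. hyperplane_reflection u y \<in> B}"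
proof (rule ccontr)
  define g where "g u = measure M {y \<in> A. hyperplane_reflection u y \<in> B}" for u
  define m where "m = measure M (space M)"
  define a where "a = measure M A * measure M B"
  assume "\<nexists>u. norm u = 1 \<and> measure M A * measure M B
      \<le> 2 * b * measure M (space M) * measure M {y \<in> A. hyperplane_reflection u y \<in> B}"
  then have less: "2 * b * m * g u < a" if "norm u = 1" for u
    using that by (force simp: g_def m_def a_def)
  obtain e :: 'a where e: "norm e = 1" using norm_Basis nonempty_Basis by blast
  have "0 \<le> 2 * b * m * g e"
    using spread_pos by (simp add: m_def g_def)
  with less[OF e] have "0 < a" by linarith
  then have "0 < measure M A"
    by (metis a_def measure_nonneg mult_zero_left order_less_le)
  moreover have "measure M A \<le> m" unfolding m_def by (rule bounded_measure)
  ultimately have "0 < m" by linarith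
  let ?E = "{z \<in> space (M \<Otimes>\<^sub>M M). snd z \<in> A \<and> hyperplane_reflection (fst z) (snd z) \<in> B}"
  have E: "?E \<in> sets (M \<Otimes>\<^sub>M M)"
    by (rule sets_pair_reflection[OF A B])
  interpret MM: pair_sigma_finite M M ..
  have "ennreal (measure M B / b) * emeasure M A
      = (\<integral>\<^sup>+y. ennreal (measure M B / b) * indicator A y \<partial>M)"
    using A by (simp add: nn_integral_cmult_indicator)
  also have "\<dots> \<le> (\<integral>\<^sup>+y. emeasure M ((\<lambda>u. (u, y)) -` ?E) \<partial>M)"
  proof (rule nn_integral_mono)
    fix y assume "y \<in> space M"
    show "ennreal (measure M B / b) * indicator A y \<le> emeasure M ((\<lambda>u. (u, y)) -` ?E)"
    proof (cases "y \<in> A")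
      case True
      then have "norm y = 1" "y \<notin> B" using norm_of_mem[OF A] disj by auto
      then have "measure M B / b \<le> measure M {u \<in> sphere 0 1. hyperplane_reflection u y \<in> B}"
        using reflection_spread[OF _ B] spread_pos by (simp add: pos_divide_le_eq mult.commute)
      moreover have "(\<lambda>u. (u, y)) -` ?E = {u \<in> sphere 0 1. hyperplane_reflection u y \<in> B}"
        using True \<open>y \<in> space M\<close> by (auto simp: space_pair_measure space_M)
      ultimately show ?thesis
        using True by (simp add: emeasure_eq_measure ennreal_leI)
    qed simp
  qed
  also have "\<dots> = emeasure (M \<Otimes>\<^sub>M M) ?E"
    by (rule MM.emeasure_pair_measure_alt2[OF E, symmetric])
  also have "\<dots> = (\<integral>\<^sup>+u. emeasure M (Pair u -` ?E) \<partial>M)"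
    by (rule emeasure_pair_measure_alt[OF E])
  also have "\<dots> \<le> (\<integral>\<^sup>+u. ennreal (a / (2 * b * m)) \<partial>M)"
  proof (rule nn_integral_mono)
    fix u assume u: "u \<in> space M"
    have "Pair u -` ?E = {y \<in> A. hyperplane_reflection u y \<in> B}"
      using u sets.sets_into_space[OF A] by (auto simp: space_pair_measure)
    then have "emeasure M (Pair u -` ?E) = ennreal (g u)"
      by (simp add: g_def emeasure_eq_measure)
    also have "\<dots> \<le> ennreal (a / (2 * b * m))"
      using less[of u] u spread_pos \<open>0 < m\<close>
      by (intro ennreal_leI) (simp add: space_M pos_le_divide_eq mult_ac)
    finally show "emeasure M (Pair u -` ?E) \<le> ennreal (a / (2 * b * m))" .
  qed
  also have "\<dots> = ennreal (a / (2 * b * m)) * ennreal m"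
    by (simp add: m_def emeasure_eq_measure)
  finally have le: "ennreal (measure M B / b) * ennreal (measure M A)
      \<le> ennreal (a / (2 * b * m)) * ennreal m"
    by (simp only: emeasure_eq_measure)
  have "ennreal (measure M B / b * measure M A) = ennreal (measure M B / b) * ennreal (measure M A)"
    using spread_pos by (intro ennreal_mult) auto
  also note le
  also have "ennreal (a / (2 * b * m)) * ennreal m = ennreal (a / (2 * b * m) * m)"
    using spread_pos \<open>0 < m\<close> \<open>0 < a\<close> by (intro ennreal_mult[symmetric]) auto
  finally have "ennreal (measure M B / b * measure M A) \<le> ennreal (a / (2 * b * m) * m)" .
  then have "measure M B / b * measure M A \<le> a / (2 * b * m) * m"
    using spread_pos \<open>0 < m\<close> \<open>0 < a\<close> by (subst (asm) ennreal_le_iff) auto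
  then have "a / b \<le> a / (2 * b)"
    using \<open>0 < m\<close> by (simp add: a_def mult.commute)
  then show False
    using spread_pos \<open>0 < a\<close> by (simp add: field_simps)
qed

lemma exists_polarization_gain:
  assumes A: "A \<in> sets M" and C: "C \<in> sets M" and eq: "measure M A = measure M C"
    and cap: "cap_centered_at p C"
  shows "\<exists>u. norm u = 1 \<and> (measure M (A - C))\<^sup>2
      \<le> 2 * b * measure M (space M) * (measure M (A - C) - measure M (polarization u A - C))"
proof -
  have same: "measure M (C - A) = measure M (A - C)"
    using finite_measure_Diff'[OF A C] finite_measure_Diff'[OF C A] eq by (simp add: Int_commute)
  obtain v where v: "norm v = 1" and gain: "measure M (C - A) * measure M (A - C)
      \<le> 2 * b * measure M (space M)
        * measure M {y \<in> C - A. hyperplane_reflection v y \<in> A - C}"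
    using exists_reflection_exchanging_mass[of "C - A" "A - C"] A C by auto
  \<comment> \<open>A mirror has two unit normals; the one pointing to the side of the centre is used.\<close>
  define u where "u = (if 0 \<le> v \<bullet> p then v else - v)"
  have u: "norm u = 1" "0 \<le> u \<bullet> p" "hyperplane_reflection u = hyperplane_reflection v"
    using v by (auto simp: u_def)
  have "measure M {y \<in> C - A. hyperplane_reflection v y \<in> A - C}
      \<le> measure M (A - C) - measure M (polarization u A - C)"
    using polarization_toward_cap[OF u(1) A C u(2) cap] u(3) by simp
  then have "2 * b * measure M (space M)
        * measure M {y \<in> C - A. hyperplane_reflection v y \<in> A - C}
      \<le> 2 * b * measure M (space M) * (measure M (A - C) - measure M (polarization u A - C))"
    using spread_pos by (intro mult_left_mono) auto
  with gain show ?thesis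
    using u(1) by (intro exI[of _ u]) (simp add: same power2_eq_square)
qed

text \<open>
  The infimum of the mass outside the cap, over all sets with the measure of \<open>A\<close> and at least its
  energy, is \<open>0\<close>: near a positive infimum \<open>l\<close>, one more polarization would gain at least
  a fixed multiple of \<open>l\<^sup>2\<close> and lead below \<open>l\<close>. Taking the infimum over all such sets, rather than a limit along a
  sequence of polarizations, avoids any compactness argument.
\<close>

lemma polarizations_approach_cap:
  assumes A: "A \<in> sets M" and C: "C \<in> sets M" and eq: "measure M A = measure M C"
    and cap: "cap_centered_at p C"
    and "0 < \<epsilon>"
  shows "\<exists>B\<in>sets M. halfspace_energy N A \<le> halfspace_energy N B \<and> measure M (B - C) < \<epsilon>"
proof -
  define \<B> where "\<B> = {B \<in> sets M. measure M B = measure M C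
    \<and> halfspace_energy N A \<le> halfspace_energy N B}"
  define l where "l = (INF B\<in>\<B>. measure M (B - C))"
  have "A \<in> \<B>" using A eq by (simp add: \<B>_def)
  have bdd: "bdd_below ((\<lambda>B. measure M (B - C)) ` \<B>)"
    by (rule bdd_belowI[of _ 0]) auto
  have low: "l \<le> measure M (B - C)" if "B \<in> \<B>" for B
    unfolding l_def using bdd that by (rule cINF_lower)
  have approx: "\<exists>B\<in>\<B>. measure M (B - C) < t" if "l < t" for t
    using that bdd \<open>A \<in> \<B>\<close> unfolding l_def by (subst (asm) cINF_less_iff) auto
  have "l \<le> 0"
  proof (rule ccontr)
    assume "\<not> l \<le> 0"
    then have "0 < l" by simp
    define k where "k = 2 * b * measure M (space M)"
    have "l \<le> measure M (space M)"
      using low[OF \<open>A \<in> \<B>\<close>] bounded_measure[of "A - C"] by linarith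
    then have "0 < k" using \<open>0 < l\<close> spread_pos by (simp add: k_def)
    have "l < l + l\<^sup>2 / k" using \<open>0 < l\<close> \<open>0 < k\<close> by simp
    then obtain B where B: "B \<in> \<B>" "measure M (B - C) < l + l\<^sup>2 / k"
      using approx by blast
    then have B': "B \<in> sets M" "measure M B = measure M C" by (auto simp: \<B>_def)
    obtain u where u: "norm u = 1" and gain: "(measure M (B - C))\<^sup>2
        \<le> k * (measure M (B - C) - measure M (polarization u B - C))"
      using exists_polarization_gain[OF B'(1) C B'(2) cap] by (auto simp: k_def)
    have "polarization u B \<in> \<B>"
      using B(1) u sets_polarization[OF u B'(1)] measure_polarization[OF u B'(1)]
        halfspace_energy_polarization[OF u B'(1), of N]
      by (auto simp: \<B>_def)
    then have "l \<le> measure M (polarization u B - C)" by (rule low)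
    moreover have "l\<^sup>2 \<le> (measure M (B - C))\<^sup>2"
      using low[OF B(1)] \<open>0 < l\<close> by (intro power_mono) auto
    ultimately have "l\<^sup>2 \<le> k * (measure M (B - C) - l)"
      using gain \<open>0 < k\<close> by (smt (verit) mult_left_mono)
    then have "l\<^sup>2 / k \<le> measure M (B - C) - l"
      using \<open>0 < k\<close> by (simp add: pos_divide_le_eq mult.commute)
    with B(2) show False by linarith
  qed
  with \<open>0 < \<epsilon>\<close> obtain B where "B \<in> \<B>" "measure M (B - C) < \<epsilon>"
    using approx[of \<epsilon>] by auto
  then show ?thesis by (auto simp: \<B>_def)
qed

text \<open>
  The masses that \<open>B\<close> and \<open>C\<close> have in a hemisphere differ at most by \<open>measure M (B - C)\<close> in this
  direction, uniformly in the hemisphere. The constant \<open>R\<close> is chosen to bound the masses involved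
  and to be at least \<open>1\<close>, as \<open>power_add_le_linear\<close> requires.
\<close>

lemma halfspace_energy_le_add:
  assumes B: "B \<in> sets M" and C: "C \<in> sets M"
  defines "R \<equiv> 1 + 2 * measure M (space M)"
  shows "halfspace_energy N B
    \<le> halfspace_energy N C + measure M (B - C) * (real N * R ^ N * measure M (space M))"
proof -
  let ?\<delta> = "measure M (B - C)"
  have le: "halfspace_mass B x ^ N \<le> halfspace_mass C x ^ N + ?\<delta> * (real N * R ^ N)" for x
  proof -
    have "halfspace_mass B x \<le> measure M ({y \<in> C. x \<bullet> y \<le> 0} \<union> (B - C))"
      unfolding halfspace_mass_def using B C
      by (intro finite_measure_mono) (auto intro!: sets.Un sets_halfspace_part)
    also have "\<dots> \<le> halfspace_mass C x + ?\<delta>"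
      unfolding halfspace_mass_def using B C
      by (intro measure_Un_le sets_halfspace_part) auto
    finally have "halfspace_mass B x ^ N \<le> (halfspace_mass C x + ?\<delta>) ^ N"
      by (intro power_mono halfspace_mass_nonneg)
    also have "\<dots> \<le> halfspace_mass C x ^ N + ?\<delta> * (real N * R ^ N)"
      using halfspace_mass_le[of C x] bounded_measure[of "B - C"]
      by (intro power_add_le_linear halfspace_mass_nonneg) (auto simp: R_def)
    finally show ?thesis .
  qed
  have "halfspace_energy N B
      \<le> (\<integral>x. halfspace_mass C x ^ N + ?\<delta> * (real N * R ^ N) \<partial>M)"
    unfolding halfspace_energy_def
    by (intro integral_mono le Bochner_Integration.integrable_add
        integrable_halfspace_mass_power B C) simp
  also have "\<dots> = halfspace_energy N C + ?\<delta> * (real N * R ^ N * measure M (space M))"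
    using integrable_halfspace_mass_power[OF C, of N] by (simp add: halfspace_energy_def mult_ac)
  finally show ?thesis .
qed

theorem halfspace_energy_le_cap:
  assumes A: "A \<in> sets M" and C: "C \<in> sets M" and eq: "measure M A = measure M C"
    and cap: "cap_centered_at p C"
  shows "halfspace_energy N A \<le> halfspace_energy N C"
proof (rule field_le_epsilon)
  fix e :: real assume "0 < e"
  define k where "k = real N * (1 + 2 * measure M (space M)) ^ N * measure M (space M)"
  have "0 \<le> k" by (simp add: k_def)
  have "0 < e / (k + 1)" using \<open>0 < e\<close> \<open>0 \<le> k\<close> by simp
  then obtain B where B: "B \<in> sets M" "halfspace_energy N A \<le> halfspace_energy N B"
    "measure M (B - C) < e / (k + 1)"
    using polarizations_approach_cap[OF A C eq cap] by blast
  have "measure M (B - C) * k \<le> measure M (B - C) * (k + 1)"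
    by (intro mult_left_mono) auto
  also have "\<dots> \<le> e"
    using B(3) \<open>0 \<le> k\<close> by (simp add: pos_less_divide_eq)
  finally show "halfspace_energy N A \<le> halfspace_energy N C + e"
    using halfspace_energy_le_add[OF B(1) C, of N] B(2) by (simp add: k_def)
qed

end

section \<open>The expected measure of a random polar set\<close>

context reflection_invariant_sphere_measure
begin

text \<open>
  By Fubini's theorem, the expected measure is the integral over \<open>x\<close> of the probability that all
  points lie in the hemisphere opposite to \<open>x\<close>. By independence, this probability is an
  \<open>N\<close>-th power.
\<close>

theorem expectation_measure_halfspaces:
  assumes P: "prob_space P"
    and indep: "prob_space.indep_vars P (\<lambda>_. M) X {1..N}"
    and unif: "\<And>i. i \<in> {1..N} \<Longrightarrow> distr P M (X i) = uniform_measure M L"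
    and L: "L \<in> sets M" and L_pos: "0 < measure M L" and N: "1 \<le> N"
  shows "(\<integral>\<omega>. measure M {x \<in> sphere 0 1. \<forall>i\<in>{1..N}. x \<bullet> X i \<omega> \<le> 0} \<partial>P)
    = halfspace_energy N L / measure M L ^ N"
proof -
  interpret P: prob_space P by (rule P)
  interpret PM: pair_sigma_finite P M ..
  have X: "X i \<in> measurable P M" if "i \<in> {1..N}" for i
    using indep that by (auto simp: P.indep_vars_def)
  let ?E = "{z \<in> space (P \<Otimes>\<^sub>M M). \<forall>i\<in>{1..N}. snd z \<bullet> X i (fst z) \<le> 0}"
  have E: "?E \<in> sets (P \<Otimes>\<^sub>M M)"
  proof (rule sets.sets_Collect_finite_All')
    fix i assume i: "i \<in> {1..N}"
    have [measurable]: "(\<lambda>z. X i (fst z)) \<in> borel_measurable (P \<Otimes>\<^sub>M M)"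
      "snd \<in> borel_measurable (P \<Otimes>\<^sub>M M)"
      using measurable_compose[OF measurable_compose[OF measurable_fst X[OF i]]
          borel_measurable_M[of "\<lambda>x. x"]]
        measurable_compose[OF measurable_snd borel_measurable_M[of "\<lambda>x. x"]]
      by simp_all
    show "{z \<in> space (P \<Otimes>\<^sub>M M). snd z \<bullet> X i (fst z) \<le> 0} \<in> sets (P \<Otimes>\<^sub>M M)"
      by measurable
  qed (use N in auto)
  have slice: "Pair \<omega> -` ?E = {x \<in> sphere 0 1. \<forall>i\<in>{1..N}. x \<bullet> X i \<omega> \<le> 0}"
    if "\<omega> \<in> space P" for \<omega>
    using that by (auto simp: space_pair_measure space_M)
  have prob: "emeasure P ((\<lambda>\<omega>. (\<omega>, x)) -` ?E)
      = ennreal ((halfspace_mass L x / measure M L) ^ N)" if x: "x \<in> space M" for x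
  proof -
    let ?H = "{y \<in> space M. x \<bullet> y \<le> 0}"
    have H: "?H \<in> sets M"
      by (rule sets_halfspace_part) simp
    have one: "P.prob (X i -` ?H \<inter> space P) = halfspace_mass L x / measure M L"
      if i: "i \<in> {1..N}" for i
    proof -
      have "P.prob (X i -` ?H \<inter> space P) = measure (uniform_measure M L) ?H"
        using measure_distr[OF X[OF i] H] unif[OF i] by simp
      also have "\<dots> = measure M (L \<inter> ?H) / measure M L"
        using L_pos H by (intro measure_uniform_measure) (auto simp: emeasure_eq_measure)
      also have "L \<inter> ?H = {y \<in> L. x \<bullet> y \<le> 0}"
        using sets.sets_into_space[OF L] by auto
      finally show ?thesis by (simp add: halfspace_mass_def)
    qed
    have "(\<lambda>\<omega>. (\<omega>, x)) -` ?E = (\<Inter>i\<in>{1..N}. X i -` ?H \<inter> space P)"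
      using x N measurable_space[OF X] by (auto simp: space_pair_measure)
    then have "P.prob ((\<lambda>\<omega>. (\<omega>, x)) -` ?E) = (\<Prod>i\<in>{1..N}. P.prob (X i -` ?H \<inter> space P))"
      using P.indep_varsD_finite[OF indep, of "\<lambda>_. ?H"] H N by simp
    also have "\<dots> = (halfspace_mass L x / measure M L) ^ N"
      using one by simp
    finally show ?thesis by (simp add: P.emeasure_eq_measure)
  qed
  have "(\<integral>\<omega>. measure M {x \<in> sphere 0 1. \<forall>i\<in>{1..N}. x \<bullet> X i \<omega> \<le> 0} \<partial>P)
      = (\<integral>\<omega>. enn2real (emeasure M (Pair \<omega> -` ?E)) \<partial>P)"
    by (intro Bochner_Integration.integral_cong refl) (simp only: slice measure_def)
  also have "\<dots> = enn2real (\<integral>\<^sup>+\<omega>. ennreal (enn2real (emeasure M (Pair \<omega> -` ?E))) \<partial>P)"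
    using measurable_emeasure_Pair[OF E] by (intro integral_eq_nn_integral) auto
  also have "(\<integral>\<^sup>+\<omega>. ennreal (enn2real (emeasure M (Pair \<omega> -` ?E))) \<partial>P)
      = (\<integral>\<^sup>+\<omega>. emeasure M (Pair \<omega> -` ?E) \<partial>P)"
    by (simp add: emeasure_eq_measure)
  also have "\<dots> = emeasure (P \<Otimes>\<^sub>M M) ?E"
    by (rule emeasure_pair_measure_alt[OF E, symmetric])
  also have "\<dots> = (\<integral>\<^sup>+x. emeasure P ((\<lambda>\<omega>. (\<omega>, x)) -` ?E) \<partial>M)"
    by (rule PM.emeasure_pair_measure_alt2[OF E])
  also have "\<dots> = (\<integral>\<^sup>+x. ennreal ((halfspace_mass L x / measure M L) ^ N) \<partial>M)"
    by (intro nn_integral_cong prob)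
  also have "enn2real \<dots> = (\<integral>x. (halfspace_mass L x / measure M L) ^ N \<partial>M)"
    using measurable_halfspace_mass[OF L]
    by (intro integral_eq_nn_integral[symmetric]) (auto simp: halfspace_mass_nonneg)
  also have "\<dots> = halfspace_energy N L / measure M L ^ N"
    by (simp add: power_divide halfspace_energy_def)
  finally show ?thesis .
qed

end

section \<open>Polar sets of spherical hulls\<close>

text \<open>
  Equality in the triangle inequality for the spherical distance forces \<open>w\<close> onto the great circle
  arc from \<open>x\<close> to \<open>y\<close>; the formula is spherical linear interpolation. The difference of both sides
  has squared norm \<open>0\<close>.
\<close>

lemma point_on_shortest_arc:
  fixes x y w :: "'a::real_inner"
  assumes norms: "norm x = 1" "norm y = 1" "norm w = 1"
    and xw: "x \<bullet> w = cos \<alpha>" and wy: "w \<bullet> y = cos \<beta>" and xy: "x \<bullet> y = cos (\<alpha> + \<beta>)"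
  shows "sin (\<alpha> + \<beta>) *\<^sub>R w = sin \<beta> *\<^sub>R x + sin \<alpha> *\<^sub>R y"
proof -
  define v where "v = sin (\<alpha> + \<beta>) *\<^sub>R w - sin \<beta> *\<^sub>R x - sin \<alpha> *\<^sub>R y"
  have unit: "x \<bullet> x = 1" "y \<bullet> y = 1" "w \<bullet> w = 1"
    using norms by (simp_all add: dot_square_norm)
  have "v \<bullet> v = (sin (\<alpha> + \<beta>))\<^sup>2 + (sin \<beta>)\<^sup>2 + (sin \<alpha>)\<^sup>2
      - 2 * sin (\<alpha> + \<beta>) * sin \<beta> * (x \<bullet> w) - 2 * sin (\<alpha> + \<beta>) * sin \<alpha> * (w \<bullet> y)
      + 2 * sin \<alpha> * sin \<beta> * (x \<bullet> y)"
    unfolding v_def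
    by (simp add: inner_diff_left inner_diff_right unit inner_commute[of w x] inner_commute[of y w]
        inner_commute[of y x] power2_eq_square algebra_simps)
  also have "\<dots> = (sin \<alpha>)\<^sup>2 + (sin \<beta>)\<^sup>2 - (sin (\<alpha> + \<beta>))\<^sup>2 + 2 * sin \<alpha> * sin \<beta> * cos (\<alpha> + \<beta>)"
    unfolding xw wy xy sin_add by (simp add: power2_eq_square algebra_simps)
  also have "\<dots> = 0"
  proof -
    have "s\<^sup>2 + s'\<^sup>2 - (s * c' + c * s')\<^sup>2 + 2 * s * s' * (c * c' - s * s')
        = s\<^sup>2 * (1 - (s'\<^sup>2 + c'\<^sup>2)) + s'\<^sup>2 * (1 - (s\<^sup>2 + c\<^sup>2))" for s c s' c' :: real
      by (simp add: power2_eq_square algebra_simps)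
    then show ?thesis by (simp add: sin_add cos_add)
  qed
  finally have "v = 0" by simp
  then show ?thesis
    by (simp add: v_def algebra_simps)
qed

text \<open>
  A point of the shortest arc from \<open>y\<close> to \<open>z\<close> is a nonnegative combination of \<open>y\<close> and \<open>z\<close>, hence
  satisfies every homogeneous linear inequality that both end points satisfy. The combination
  degenerates for \<open>\<theta> = 0\<close>, where the arc is a point, and for \<open>\<theta> = pi\<close>, where the end points are
  antipodal.
\<close>

lemma spherically_convex_halfspace:
  fixes x :: "real ^ 'd"
  shows "spherically_convex {y \<in> sphere 0 1. x \<bullet> y \<le> 0}"
  unfolding spherically_convex_def geodesic_segment_def
proof (intro conjI ballI impI subsetI)
  fix y z w
  assume y: "y \<in> {y \<in> sphere 0 1. x \<bullet> y \<le> 0}" and z: "z \<in> {y \<in> sphere 0 1. x \<bullet> y \<le> 0}"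
    and "y \<noteq> - z" and "w \<in> (\<Union>\<gamma>\<in>{\<gamma>. shortest_geodesic \<gamma> y z}. \<gamma> ` {0..1})"
  then obtain \<gamma> t where \<gamma>: "shortest_geodesic \<gamma> y z" and t: "0 \<le> t" "t \<le> 1" and w: "w = \<gamma> t"
    by auto
  have n: "norm y = 1" "norm z = 1" "norm w = 1"
    using y z \<gamma> t w by (auto simp: shortest_geodesic_def image_subset_iff)
  have bound: "-1 \<le> a \<bullet> b \<and> a \<bullet> b \<le> 1" if "norm a = 1" "norm b = 1" for a b :: "real ^ 'd"
    using Cauchy_Schwarz_ineq2[of a b] that by auto
  define \<theta> where "\<theta> = geodesic_dist y z"
  have dist: "geodesic_dist (\<gamma> s) (\<gamma> s') = \<bar>s - s'\<bar> * \<theta>"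
    if "s \<in> {0..1}" "s' \<in> {0..1}" for s s'
    using \<gamma> that by (simp add: shortest_geodesic_def \<theta>_def)
  have "\<gamma> 0 = y" "\<gamma> 1 = z" using \<gamma> by (auto simp: shortest_geodesic_def)
  then have d: "arccos (y \<bullet> w) = t * \<theta>" "arccos (w \<bullet> z) = (1 - t) * \<theta>" "arccos (y \<bullet> z) = \<theta>"
    using dist[of 0 t] dist[of t 1] dist[of 0 1] t w by (auto simp: geodesic_dist_def)
  have cos_angle: "a \<bullet> b = cos (arccos (a \<bullet> b))" if "norm a = 1" "norm b = 1" for a b :: "real ^ 'd"
    using bound[OF that] by simp
  have angles: "t * \<theta> + (1 - t) * \<theta> = \<theta>" by (simp add: algebra_simps)
  have c: "y \<bullet> w = cos (t * \<theta>)" "w \<bullet> z = cos ((1 - t) * \<theta>)"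
      "y \<bullet> z = cos (t * \<theta> + (1 - t) * \<theta>)"
    unfolding angles using cos_angle[OF n(1,3)] cos_angle[OF n(3,2)] cos_angle[OF n(1,2)]
    by (simp_all only: d)
  have comb: "sin \<theta> *\<^sub>R w = sin ((1 - t) * \<theta>) *\<^sub>R y + sin (t * \<theta>) *\<^sub>R z"
    using point_on_shortest_arc[OF n c] unfolding angles .
  have \<theta>: "0 \<le> \<theta>" "\<theta> \<le> pi"
    using d(3) bound[of y z] n arccos_lbound arccos_ubound by (auto simp flip: d(3))
  have "x \<bullet> w \<le> 0"
  proof (cases "\<theta> = 0")
    case True
    then have "y \<bullet> w = 1" using c(1) by simp
    then have "(norm (y - w))\<^sup>2 = 0"
      using n dot_norm_neg[of y w] by simp
    then have "w = y" by simp
    then show ?thesis using y by simp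
  next
    case False
    have "\<theta> \<noteq> pi"
    proof
      assume "\<theta> = pi"
      then have "y \<bullet> z = -1" using c(3) unfolding angles by simp
      then have "(norm (y + z))\<^sup>2 = 0"
        using n dot_norm[of y z] by simp
      then show False using \<open>y \<noteq> - z\<close> by (simp add: eq_neg_iff_add_eq_0)
    qed
    then have "0 < sin \<theta>" using False \<theta> by (intro sin_gt_zero) auto
    have mult: "0 \<le> s * \<theta> \<and> s * \<theta> \<le> pi" if "0 \<le> s" "s \<le> 1" for s
      using \<theta> that mult_left_le_one_le[of \<theta> s] by auto
    have "0 \<le> sin ((1 - t) * \<theta>)" "0 \<le> sin (t * \<theta>)"
      using mult[of "1 - t"] mult[of t] t by (auto intro!: sin_ge_zero)
    then have "sin ((1 - t) * \<theta>) * (x \<bullet> y) + sin (t * \<theta>) * (x \<bullet> z) \<le> 0"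
      using y z by (intro add_nonpos_nonpos mult_nonneg_nonpos) auto
    also have "sin ((1 - t) * \<theta>) * (x \<bullet> y) + sin (t * \<theta>) * (x \<bullet> z) = sin \<theta> * (x \<bullet> w)"
      using arg_cong[OF comb, of "\<lambda>v. x \<bullet> v"] by (simp add: inner_add_right)
    finally show ?thesis
      using \<open>0 < sin \<theta>\<close> by (simp add: mult_le_0_iff)
  qed
  then show "w \<in> {y \<in> sphere 0 1. x \<bullet> y \<le> 0}" using n by simp
qed auto

text \<open>
  A closed hemisphere that contains the points contains their hull, because it is convex.
\<close>

lemma spherical_polar_hull:
  assumes "F \<subseteq> sphere 0 1"
  shows "spherical_polar (spherical_hull F) = spherical_polar F"
proof
  have "F \<subseteq> spherical_hull F" by (auto simp: spherical_hull_def)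
  then show "spherical_polar (spherical_hull F) \<subseteq> spherical_polar F"
    by (auto simp: spherical_polar_def)
  show "spherical_polar F \<subseteq> spherical_polar (spherical_hull F)"
  proof
    fix x assume x: "x \<in> spherical_polar F"
    have "spherical_hull F \<subseteq> {y \<in> sphere 0 1. x \<bullet> y \<le> 0}"
      unfolding spherical_hull_def using assms x spherically_convex_halfspace[of x]
      by (intro Inter_lower) (auto simp: spherical_polar_def)
    then show "x \<in> spherical_polar (spherical_hull F)"
      using x by (auto simp: spherical_polar_def)
  qed
qed

section \<open>The Hausdorff measure on the sphere\<close>

lemma sets_hausdorff_measure: "sets (hausdorff_measure n) = sets borel"
  unfolding hausdorff_measure_def using sets.sigma_sets_eq[of borel] by simp

lemma sets_sphere_measure: "sets (sphere_measure n) = sets (restrict_space borel (sphere 0 1))"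
  unfolding sphere_measure_def by (rule sets_restrict_space_cong) (rule sets_hausdorff_measure)

lemma sets_sphere_measure_iff:
  "A \<in> sets (sphere_measure n) \<longleftrightarrow> A \<in> sets borel \<and> A \<subseteq> sphere 0 1"
  unfolding sets_sphere_measure by (subst sets_restrict_space_iff) auto

text \<open>
  \<^const>\<open>measure_of\<close> yields the zero measure unless the given set function is a measure on the
  generated \<open>\<sigma>\<close>-algebra. A single set of positive measure therefore certifies that the Hausdorff
  outer measure is countably additive on the Borel sets.
\<close>

lemma emeasure_sphere_measure_eq_hausdorff_outer:
  fixes K A :: "(real ^ 'd) set"
  assumes "0 < emeasure (sphere_measure n) K" and A: "A \<in> sets (sphere_measure n)"
  shows "emeasure (sphere_measure n) A = hausdorff_outer n A"
proof -
  have restrict: "emeasure (sphere_measure n) B = emeasure (hausdorff_measure n) B"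
    if "B \<in> sets (sphere_measure n)" for B :: "(real ^ 'd) set"
    unfolding sphere_measure_def using that
    by (intro emeasure_restrict_space) (auto simp: sets_hausdorff_measure sets_sphere_measure_iff)
  have "K \<in> sets (sphere_measure n)"
    using assms(1) emeasure_notin_sets by fastforce
  then have "0 < emeasure (hausdorff_measure n) K"
    using assms(1) restrict by simp
  then have "measure_space UNIV (sigma_sets UNIV (sets borel)) (hausdorff_outer n :: (real ^ 'd) set \<Rightarrow> _)"
    unfolding hausdorff_measure_def by (simp add: emeasure_measure_of_conv split: if_splits)
  moreover have "A \<in> sigma_sets UNIV (sets borel)"
    using A by (auto simp: sets_sphere_measure_iff)
  ultimately show ?thesis
    using restrict[OF A] unfolding hausdorff_measure_def by (simp add: emeasure_measure_of_conv)
qed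

lemma spherical_cap_centered:
  assumes "spherical_cap C"
  obtains p where "cap_centered_at p C"
proof -
  from assms obtain p r where p: "norm p = 1" and C: "C = {y \<in> sphere 0 1. arccos (p \<bullet> y) \<le> r}"
    by (auto simp: spherical_cap_def geodesic_dist_def)
  have "cap_centered_at p C"
    unfolding cap_centered_at_def
  proof (intro ballI allI impI)
    fix y z assume y: "y \<in> C" and z: "norm z = 1" and le: "p \<bullet> y \<le> p \<bullet> z"
    have "-1 \<le> p \<bullet> y" "p \<bullet> z \<le> 1"
      using Cauchy_Schwarz_ineq2[of p y] Cauchy_Schwarz_ineq2[of p z] p y z C by auto
    then have "arccos (p \<bullet> z) \<le> arccos (p \<bullet> y)"
      using le by (intro arccos_le_arccos) auto
    then show "z \<in> C" using y z C by auto
  qed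
  then show ?thesis by (rule that)
qed

lemma spherical_cap_contains_neighbourhood:
  fixes C :: "(real ^ 'd) set"
  assumes "spherical_cap C"
  obtains p where "C = {p}"
  | p d where "norm p = 1" "0 < d" "\<And>y. norm y = 1 \<Longrightarrow> dist p y < d \<Longrightarrow> y \<in> C"
proof -
  from assms obtain p r where p: "norm p = 1" and r: "0 \<le> r"
    and C: "C = {y \<in> sphere 0 1. arccos (p \<bullet> y) \<le> r}"
    by (auto simp: spherical_cap_def geodesic_dist_def)
  have bound: "-1 \<le> p \<bullet> y \<and> p \<bullet> y \<le> 1" if "norm y = 1" for y
    using Cauchy_Schwarz_ineq2[of p y] p that by auto
  have dist: "(dist p y)\<^sup>2 = 2 - 2 * (p \<bullet> y)" if "norm y = 1" for y
    using dot_norm_neg[of p y] p that by (simp add: dist_norm)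
  show ?thesis
  proof (cases "r = 0")
    case True
    have "y = p" if "y \<in> C" for y
    proof -
      have "norm y = 1" using that C by auto
      have "arccos (p \<bullet> y) = 0"
        using that True arccos_lbound[of "p \<bullet> y"] bound[OF \<open>norm y = 1\<close>] by (auto simp: C)
      then have "p \<bullet> y = 1"
        using cos_arccos[of "p \<bullet> y"] bound[OF \<open>norm y = 1\<close>] by simp
      then show ?thesis using dist[OF \<open>norm y = 1\<close>] by simp
    qed
    moreover have "p \<in> C" using p r by (simp add: C dot_square_norm)
    ultimately have "C = {p}" by blast
    then show ?thesis by (rule that(1))
  next
    case False
    \<comment> \<open>A radius that is below \<open>pi\<close>, so that \<open>arccos\<close> inverts \<open>cos\<close> there.\<close>
    define \<rho> where "\<rho> = min r 1"
    have \<rho>: "0 < \<rho>" "\<rho> \<le> r" "\<rho> \<le> pi" using r False pi_gt3 by (auto simp: \<rho>_def)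
    then have "cos \<rho> < 1" using cos_monotone_0_pi[of 0 \<rho>] by simp
    show ?thesis
    proof (rule that(2))
      show "norm p = 1" by (rule p)
      show "0 < sqrt (2 - 2 * cos \<rho>)" using \<open>cos \<rho> < 1\<close> by simp
      fix y assume y: "norm y = 1" and "dist p y < sqrt (2 - 2 * cos \<rho>)"
      then have "(dist p y)\<^sup>2 < (sqrt (2 - 2 * cos \<rho>))\<^sup>2"
        by (intro power_strict_mono) auto
      then have "cos \<rho> \<le> p \<bullet> y"
        using dist[OF y] \<open>cos \<rho> < 1\<close> by simp
      then have "arccos (p \<bullet> y) \<le> arccos (cos \<rho>)"
        using bound[OF y] by (intro arccos_le_arccos) auto
      then show "y \<in> C" using \<rho> y by (simp add: C arccos_cos)
    qed
  qed
qed

text \<open>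
  A cap of positive measure is not a single point, hence contains a neighbourhood of its centre in
  the sphere. Finitely many mirror images of this neighbourhood cover the compact sphere.
\<close>

lemma finite_sphere_measure_of_cap:
  fixes C :: "(real ^ 'd) set"
  assumes "1 \<le> n" and cap: "spherical_cap C"
    and pos: "0 < emeasure (sphere_measure n) C" and fin: "emeasure (sphere_measure n) C < \<infinity>"
  shows "emeasure (sphere_measure n) (sphere 0 1 :: (real ^ 'd) set) < \<infinity>"
proof -
  note outer = emeasure_sphere_measure_eq_hausdorff_outer[OF pos]
  have C: "C \<in> sets (sphere_measure n)"
    using pos emeasure_notin_sets by fastforce
  have "hausdorff_outer n C \<noteq> 0" using pos outer[OF C] by simp
  then have "C \<noteq> {p}" for p using hausdorff_outer_singleton[OF \<open>1 \<le> n\<close>] by auto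
  then obtain p d where p: "norm p = 1" "0 < d"
    and near: "\<And>y. norm y = 1 \<Longrightarrow> dist p y < d \<Longrightarrow> y \<in> C"
    using spherical_cap_contains_neighbourhood[OF cap] by metis
  define W where "W q = {y \<in> sphere 0 1. dist q y < d}" for q :: "real ^ 'd"
  have W: "W q \<in> sets (sphere_measure n)" for q
  proof -
    have "W q = sphere 0 1 \<inter> ball q d" by (auto simp: W_def)
    then show ?thesis by (auto simp: sets_sphere_measure_iff)
  qed
  have "W p \<subseteq> C" using near by (auto simp: W_def)
  then have Wp: "emeasure (sphere_measure n) (W p) < \<infinity>"
    using emeasure_mono[OF _ C] fin by (metis order_le_less_trans)
  have Wq: "emeasure (sphere_measure n) (W q) < \<infinity>" if q: "norm q = 1" for q
  proof (cases "q = p")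
    case False
    define u where "u = (p - q) /\<^sub>R norm (p - q)"
    have u: "norm u = 1" using False by (simp add: u_def)
    have up: "hyperplane_reflection u p = q"
      unfolding u_def using p q False by (intro reflection_exchange) auto
    have "dist q y = dist p (hyperplane_reflection u y)" for y
      using u by (simp add: dist_norm flip: up)
        (metis hyperplane_reflection_diff hyperplane_reflection_involutive norm_hyperplane_reflection)
    then have "hyperplane_reflection u y \<in> W p" if "y \<in> W q" for y
      using that u by (simp add: W_def)
    moreover have "hyperplane_reflection u y \<in> W q" if "y \<in> W p" for y
      using that u \<open>\<And>y. dist q y = dist p (hyperplane_reflection u y)\<close> by (simp add: W_def)
    ultimately have "W q = hyperplane_reflection u ` W p"
      using u hyperplane_reflection_involutive[OF u] by (metis image_eqI subsetI subset_antisym imageE)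
    then have "hausdorff_outer n (W q) \<le> hausdorff_outer n (W p) * ennreal (1 ^ n)"
      using hausdorff_outer_Lipschitz_image[OF zero_less_one lipschitz_hyperplane_reflection[OF u]]
      by simp
    then show ?thesis
      using Wp outer[OF W] by simp
  qed (use Wp in simp)
  obtain F where "finite F \<and> F \<subseteq> sphere 0 1 \<and> sphere (0 :: real ^ 'd) 1 \<subseteq> (\<Union>q\<in>F. ball q d)"
    using seq_compact_imp_totally_bounded[OF compact_imp_seq_compact[OF
        compact_sphere[of "0 :: real ^ 'd" 1]], rule_format, OF p(2)]
    by (elim exE) (rule that)
  then have F: "finite F" "F \<subseteq> sphere 0 1" "sphere 0 1 \<subseteq> (\<Union>q\<in>F. ball q d)"
    by simp_all
  then have "sphere 0 1 \<subseteq> (\<Union>q\<in>F. W q)" by (fastforce simp: W_def)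
  then have "emeasure (sphere_measure n) (sphere 0 1 :: (real ^ 'd) set)
      \<le> emeasure (sphere_measure n) (\<Union>q\<in>F. W q)"
    using F W by (intro emeasure_mono) auto
  also have "\<dots> \<le> (\<Sum>q\<in>F. emeasure (sphere_measure n) (W q))"
    using F W by (intro emeasure_subadditive_finite) auto
  also have "\<dots> < \<infinity>"
    using F Wq by (auto simp: ennreal_sum_less_top)
  finally show ?thesis .
qed

text \<open>
  Reflections are isometries. The bound on the spread holds with \<open>4 ^ n\<close>, because \<open>B\<close> is the
  image of the set of mirrors that send \<open>y\<close> into \<open>B\<close> under a map with Lipschitz constant \<open>4\<close>.
\<close>

lemma reflection_invariant_sphere_measure:
  fixes K :: "(real ^ 'd) set"
  assumes pos: "0 < emeasure (sphere_measure n) K"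
    and fin: "emeasure (sphere_measure n) (sphere 0 1 :: (real ^ 'd) set) < \<infinity>"
  shows "reflection_invariant_sphere_measure (sphere_measure n :: (real ^ 'd) measure) (4 ^ n)"
proof -
  let ?M = "sphere_measure n :: (real ^ 'd) measure"
  note outer = emeasure_sphere_measure_eq_hausdorff_outer[OF pos]
  have space: "space ?M = sphere 0 1"
    using sets_eq_imp_space_eq[OF sets_sphere_measure[of n]] by (simp add: space_restrict_space)
  interpret finite_measure ?M
    using fin by (intro finite_measureI) (auto simp: space)
  show ?thesis
  proof
    show "sets ?M = sets (restrict_space borel (sphere 0 1))"
      by (rule sets_sphere_measure)
    show "(0::real) < 4 ^ n" by simp
  next
    fix u :: "real ^ 'd" and A assume u: "norm u = 1" and A: "A \<in> sets ?M"
    let ?A' = "{y \<in> sphere 0 1. hyperplane_reflection u y \<in> A}"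
    have [measurable]: "A \<in> sets borel" and sub: "A \<subseteq> sphere 0 1"
      using A by (auto simp: sets_sphere_measure_iff)
    have "?A' \<in> sets borel" by measurable
    then have A': "?A' \<in> sets ?M" by (auto simp: sets_sphere_measure_iff)
    have le: "hausdorff_outer n (hyperplane_reflection u ` B) \<le> hausdorff_outer n B" for B
      using hausdorff_outer_Lipschitz_image[OF zero_less_one lipschitz_hyperplane_reflection[OF u], of n B]
      by simp
    have r: "hyperplane_reflection u (hyperplane_reflection u y) = y" for y
      using u by simp
    have "hyperplane_reflection u ` A = ?A'"
    proof (intro set_eqI iffI)
      fix y assume "y \<in> ?A'"
      then show "y \<in> hyperplane_reflection u ` A" by (metis (lifting) image_eqI mem_Collect_eq r)
    qed (use u sub in auto)
    moreover from this have "hyperplane_reflection u ` ?A' = A"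
      using r by (metis (no_types, lifting) image_image image_cong image_ident)
    ultimately have "hausdorff_outer n ?A' = hausdorff_outer n A"
      using le[of A] le[of ?A'] by simp
    then show "emeasure ?M ?A' = emeasure ?M A"
      unfolding outer[OF A] outer[OF A'] .
  next
    fix y :: "real ^ 'd" and B assume y: "norm y = 1" and B: "B \<in> sets ?M" and "y \<notin> B"
    let ?U = "{u \<in> sphere 0 1. hyperplane_reflection u y \<in> B}"
    have [measurable]: "B \<in> sets borel" and sub: "B \<subseteq> sphere 0 1"
      using B by (auto simp: sets_sphere_measure_iff)
    have "?U \<in> sets borel" by measurable
    then have U: "?U \<in> sets ?M" by (auto simp: sets_sphere_measure_iff)
    have image: "(\<lambda>u. hyperplane_reflection u y) ` ?U = B"
    proof (intro set_eqI iffI)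
      fix z assume z: "z \<in> B"
      then have "norm z = 1" "z \<noteq> y" using sub \<open>y \<notin> B\<close> by auto
      then have "hyperplane_reflection ((y - z) /\<^sub>R norm (y - z)) y = z"
        using y by (intro reflection_exchange)
      moreover from this z \<open>z \<noteq> y\<close> have "(y - z) /\<^sub>R norm (y - z) \<in> ?U" by simp
      ultimately show "z \<in> (\<lambda>u. hyperplane_reflection u y) ` ?U" by (metis (lifting) image_eqI)
    qed auto
    have "4-lipschitz_on ?U (\<lambda>u. hyperplane_reflection u y)"
      using lipschitz_reflection_in_normal[OF y] by (rule lipschitz_on_subset) auto
    then have "hausdorff_outer n B \<le> hausdorff_outer n ?U * ennreal (4 ^ n)"
      using hausdorff_outer_Lipschitz_image[of 4 ?U "\<lambda>u. hyperplane_reflection u y" n]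
      unfolding image by simp
    then have "emeasure ?M B \<le> emeasure ?M ?U * ennreal (4 ^ n)"
      unfolding outer[OF B] outer[OF U] .
    then have "ennreal (measure ?M B) \<le> ennreal (measure ?M ?U * 4 ^ n)"
      by (simp only: emeasure_eq_measure) (simp add: ennreal_mult)
    then show "measure ?M B \<le> 4 ^ n * measure ?M ?U"
      by (subst (asm) ennreal_le_iff) (auto simp: mult.commute)
  qed
qed

section \<open>Comparison with a cap\<close>

theorem corollary1p4:
  fixes n N :: nat
    and K C :: "(real ^ 'd) set"
    and P :: "'p measure" and X :: "nat \<Rightarrow> 'p \<Rightarrow> real ^ 'd"
    and Q :: "'q measure" and Y :: "nat \<Rightarrow> 'q \<Rightarrow> real ^ 'd"
  assumes "n \<ge> 1" and "CARD('d) = n + 1"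
    and "K \<subseteq> sphere 0 1" and "compact K" and "proper_subset K"
    and "emeasure (sphere_measure n) K > 0"
    and "spherical_cap C"
    and "emeasure (sphere_measure n) C = emeasure (sphere_measure n) K"
    and "independent_uniform_points n K N P X"
    and "independent_uniform_points n C N Q Y"
  shows "prob_space.expectation P
           (\<lambda>\<omega>. measure (sphere_measure n) (spherical_polar (random_hull X N \<omega>)))
       \<le> prob_space.expectation Q
           (\<lambda>\<omega>. measure (sphere_measure n) (spherical_polar (random_hull Y N \<omega>)))"
proof (cases "N = 0")
  case True
  \<comment> \<open>Both hulls are the same set, the hull of no points, so both expectations are that of one constant.\<close>
  have "prob_space P" "prob_space Q"
    using assms by (auto simp: independent_uniform_points_def)
  then show ?thesis
    using True by (simp add: random_hull_def prob_space.prob_space)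
next
  case False
  let ?M = "sphere_measure n :: (real ^ 'd) measure"
  note pos = assms(6)
  have K: "K \<in> sets ?M" using pos emeasure_notin_sets by fastforce
  have C: "C \<in> sets ?M" using pos assms(8) emeasure_notin_sets by fastforce
  \<comment> \<open>A set of infinite measure carries no uniform distribution, but the first point has one.\<close>
  have fin: "emeasure ?M K < \<infinity>"
  proof (rule ccontr)
    assume "\<not> emeasure ?M K < \<infinity>"
    then have "emeasure ?M K = \<infinity>" by (simp flip: less_top)
    interpret P: prob_space P using assms(9) by (simp add: independent_uniform_points_def)
    have one: "1 \<in> {1..N}" using False by simp
    then have "X 1 \<in> measurable P ?M" and unif: "distr P ?M (X 1) = uniform_measure ?M K"
      using assms(9) by (auto simp: independent_uniform_points_def P.indep_vars_def)
    then have "prob_space (uniform_measure ?M K)"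
      using P.prob_space_distr by metis
    then have "emeasure (uniform_measure ?M K) (space ?M) = 1"
      using prob_space.emeasure_space_1 by fastforce
    then show False
      using K \<open>emeasure ?M K = \<infinity>\<close> by (simp add: emeasure_uniform_measure)
  qed
  have fin_M: "emeasure ?M (sphere 0 1) < \<infinity>"
    using assms(8) pos fin by (intro finite_sphere_measure_of_cap[OF assms(1,7)]) auto
  interpret reflection_invariant_sphere_measure ?M "4 ^ n"
    using pos fin_M by (rule reflection_invariant_sphere_measure)
  have eq: "measure ?M K = measure ?M C" using assms(8) by (simp add: measure_def)
  have K_pos: "0 < measure ?M K" using pos by (simp add: emeasure_eq_measure)
  have expect: "prob_space.expectation R
      (\<lambda>\<omega>. measure ?M (spherical_polar (random_hull Z N \<omega>))) = halfspace_energy N L / measure ?M L ^ N"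
    if Z: "independent_uniform_points n L N R Z" and L: "L \<in> sets ?M" "0 < measure ?M L"
    for R :: "'r measure" and Z L
  proof -
    interpret R: prob_space R using Z by (simp add: independent_uniform_points_def)
    have indep: "R.indep_vars (\<lambda>_. ?M) Z {1..N}"
      and unif: "\<And>i. i \<in> {1..N} \<Longrightarrow> distr R ?M (Z i) = uniform_measure ?M L"
      using Z by (auto simp: independent_uniform_points_def)
    have "spherical_polar (random_hull Z N \<omega>) = {x \<in> sphere 0 1. \<forall>i\<in>{1..N}. x \<bullet> Z i \<omega> \<le> 0}"
      if "\<omega> \<in> space R" for \<omega>
    proof -
      have "(\<lambda>i. Z i \<omega>) ` {1..N} \<subseteq> sphere 0 1"
      proof safe
        fix i assume "i \<in> {1..N}"
        then have "Z i \<in> measurable R ?M" using indep by (simp add: R.indep_vars_def)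
        from measurable_space[OF this that] show "Z i \<omega> \<in> sphere 0 1" by (simp add: space_M)
      qed
      then show ?thesis
        unfolding random_hull_def by (simp add: spherical_polar_hull) (simp add: spherical_polar_def)
    qed
    then have "R.expectation (\<lambda>\<omega>. measure ?M (spherical_polar (random_hull Z N \<omega>)))
        = R.expectation (\<lambda>\<omega>. measure ?M {x \<in> sphere 0 1. \<forall>i\<in>{1..N}. x \<bullet> Z i \<omega> \<le> 0})"
      by (intro Bochner_Integration.integral_cong) auto
    also have "\<dots> = halfspace_energy N L / measure ?M L ^ N"
      using False by (intro expectation_measure_halfspaces[OF R.prob_space_axioms indep unif L]) auto
    finally show ?thesis .
  qed
  obtain p where "cap_centered_at p C"
    using spherical_cap_centered[OF assms(7)] .
  then have "halfspace_energy N K \<le> halfspace_energy N C"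
    by (rule halfspace_energy_le_cap[OF K C eq])
  then show ?thesis
    unfolding expect[OF assms(9) K K_pos] expect[OF assms(10) C K_pos[unfolded eq]] eq
    using K_pos by (intro divide_right_mono) auto
qed

end
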